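(* Let $\mathbb{K}$ be an algebraically closed field and $k\ge 2$. For every $k$-tensor $T$ over $\mathbb{K}$, $$\mathrm{PR}(T) \le (2^{k-1}-1)\,\mathrm{GR}(T).$$
   Context: A $k$-tensor over a field $\mathbb{K}$ is a $k$-linear form $T\colon V_1\times\cdots\times V_k\to\mathbb{K}$ with $V_i$ finite-dimensional $\mathbb{K}$-vector spaces. The partition rank $\mathrm{PR}(T)$ is the smallest $r$ such that $T$ is a sum of $r$ functions $p\cdot q$, where for some partition $[k]=S\cup S'$ into two nonempty disjoint sets, $p\colon\prod_{i\in S}V_i\to\mathbb{K}$ and $q\colon\prod_{i\in S'}V_i\to\mathbb{K}$ are multilinear forms over $\mathbb{K}$. Viewing $T$ as the $(k-1)$-linear map $\bar T\colon V_1\times\cdots\times V_{k-1}\to V_k^*\cong\mathbb{K}^{\dim V_k}$, $\bar T(x)=T(x,\cdot)$ (its coordinates are the $(k-1)$-linear forms given by the slices of $T$ along the last axis), the geometric rank is $\mathrm{GR}(T)=\operatorname{codim}\ker\bar T$, the codimension in $V_1\times\cdots\times V_{k-1}$ of the variety $\ker\bar T=\{x\in V_1\times\cdots\times V_{k-1}:\bar T(x)=0\}$. *)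

theory Defs
  imports "HOL-Computational_Algebra.Polynomial"
begin

text \<open>Coordinates.  A tuple (v_i)_{i in I} with v_i in V_i = K^(d i) is encoded as a
function x :: nat \<times> nat \<Rightarrow> 'a, where x (i, j) is the j-th coordinate of v_i.\<close>

definition blockvars :: "nat set \<Rightarrow> (nat \<Rightarrow> nat) \<Rightarrow> (nat \<times> nat) set" where
  "blockvars I d = {(i, j). i \<in> I \<and> j < d i}"

definition pt_space :: "'v set \<Rightarrow> ('v \<Rightarrow> 'a::zero) set" where
  "pt_space Var = {x. \<forall>v. v \<notin> Var \<longrightarrow> x v = 0}"

definition setblk :: "(nat \<Rightarrow> nat) \<Rightarrow> (nat \<times> nat \<Rightarrow> 'a::zero) \<Rightarrow> nat \<Rightarrow> (nat \<Rightarrow> 'a) \<Rightarrow> nat \<times> nat \<Rightarrow> 'a" where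
  "setblk d x i v = (\<lambda>(a, b). if a = i then (if b < d i then v b else 0) else x (a, b))"

definition restr :: "(nat \<times> nat \<Rightarrow> 'a::zero) \<Rightarrow> nat set \<Rightarrow> nat \<times> nat \<Rightarrow> 'a" where
  "restr x S = (\<lambda>(a, b). if a \<in> S then x (a, b) else 0)"

definition multilinear :: "nat set \<Rightarrow> (nat \<Rightarrow> nat) \<Rightarrow> ((nat \<times> nat \<Rightarrow> 'a::field) \<Rightarrow> 'a) \<Rightarrow> bool" where
  "multilinear I d T \<longleftrightarrow>
     (\<forall>x \<in> pt_space (blockvars I d). \<forall>i \<in> I. \<forall>v w :: nat \<Rightarrow> 'a. \<forall>c :: 'a.
        T (setblk d x i (\<lambda>b. c * v b + w b)) = c * T (setblk d x i v) + T (setblk d x i w))"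

definition partition_rank :: "nat \<Rightarrow> (nat \<Rightarrow> nat) \<Rightarrow> ((nat \<times> nat \<Rightarrow> 'a::field) \<Rightarrow> 'a) \<Rightarrow> nat" where
  "partition_rank k d T = (LEAST r. \<exists>(S :: nat \<Rightarrow> nat set) (p :: nat \<Rightarrow> (nat \<times> nat \<Rightarrow> 'a) \<Rightarrow> 'a) q.
      (\<forall>j < r. S j \<noteq> {} \<and> S j \<subset> {..<k} \<and> multilinear (S j) d (p j)
               \<and> multilinear ({..<k} - S j) d (q j)) \<and>
      (\<forall>x \<in> pt_space (blockvars {..<k} d).
          T x = (\<Sum>j<r. p j (restr x (S j)) * q j (restr x ({..<k} - S j)))))"

inductive_set poly_fun :: "'v set \<Rightarrow> (('v \<Rightarrow> 'a::comm_ring_1) \<Rightarrow> 'a) set" for Var where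
  pf_const: "(\<lambda>x. c) \<in> poly_fun Var"
| pf_var: "v \<in> Var \<Longrightarrow> (\<lambda>x. x v) \<in> poly_fun Var"
| pf_add: "f \<in> poly_fun Var \<Longrightarrow> g \<in> poly_fun Var \<Longrightarrow> (\<lambda>x. f x + g x) \<in> poly_fun Var"
| pf_mult: "f \<in> poly_fun Var \<Longrightarrow> g \<in> poly_fun Var \<Longrightarrow> (\<lambda>x. f x * g x) \<in> poly_fun Var"

definition zariski_closed :: "'v set \<Rightarrow> ('v \<Rightarrow> 'a::comm_ring_1) set \<Rightarrow> bool" where
  "zariski_closed Var Z \<longleftrightarrow> (\<exists>F \<subseteq> poly_fun Var. Z = {x \<in> pt_space Var. \<forall>f \<in> F. f x = 0})"

definition zariski_irreducible :: "'v set \<Rightarrow> ('v \<Rightarrow> 'a::comm_ring_1) set \<Rightarrow> bool" where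
  "zariski_irreducible Var Z \<longleftrightarrow> Z \<noteq> {} \<and> zariski_closed Var Z \<and>
     (\<forall>A B. zariski_closed Var A \<and> zariski_closed Var B \<and> Z \<subseteq> A \<union> B \<longrightarrow> Z \<subseteq> A \<or> Z \<subseteq> B)"

definition zariski_dim :: "'v set \<Rightarrow> ('v \<Rightarrow> 'a::comm_ring_1) set \<Rightarrow> nat" where
  "zariski_dim Var Z = Sup {m. \<exists>C :: nat \<Rightarrow> ('v \<Rightarrow> 'a) set.
       (\<forall>i \<le> m. zariski_irreducible Var (C i) \<and> C i \<subseteq> Z) \<and> (\<forall>i < m. C i \<subset> C (Suc i))}"

text \<open>Kernel of T-bar : V_0 \<times> ... \<times> V_(k-2) \<rightarrow> V_(k-1)^*, x \<mapsto> T(x, \<cdot>); its coordinates are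
  T(x, e_j), j < d (k-1).\<close>
definition tensor_kernel :: "nat \<Rightarrow> (nat \<Rightarrow> nat) \<Rightarrow> ((nat \<times> nat \<Rightarrow> 'a::field) \<Rightarrow> 'a) \<Rightarrow> (nat \<times> nat \<Rightarrow> 'a) set" where
  "tensor_kernel k d T = {x \<in> pt_space (blockvars {..<k-1} d).
       \<forall>j < d (k-1). T (setblk d x (k-1) (\<lambda>b. if b = j then 1 else 0)) = 0}"

definition geometric_rank :: "nat \<Rightarrow> (nat \<Rightarrow> nat) \<Rightarrow> ((nat \<times> nat \<Rightarrow> 'a::field) \<Rightarrow> 'a) \<Rightarrow> nat" where
  "geometric_rank k d T = card (blockvars {..<k-1} d)
       - zariski_dim (blockvars {..<k-1} d) (tensor_kernel k d T)"

end

theory Submission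
  imports Defs
begin

text \<open>
  Let \<open>X\<close> be the top of a maximal chain of irreducible closed subsets of the kernel, of length \<open>m\<close>.
  Functions separating consecutive members of the chain give \<open>m\<close> algebraically independent functions on
  \<open>X\<close>. Adjoining the coordinates to them one at a time imposes at most one linear condition each on a
  derivation, so in every characteristic there are \<open>m\<close> vector fields tangent to \<open>X\<close>, independent
  at a generic point; after elimination, their complement is spanned by \<open>r = codim X\<close> coordinate vectors.

  The form \<open>T (\<xi>, \<cdot>)\<close> vanishes for \<open>\<xi>\<close> in \<open>X\<close>. Differentiating in the \<open>s\<close>-th block replaces \<open>\<xi>\<^sub>s\<close>
  by a free vector \<open>x\<^sub>s\<close>. The tangential part of this direction turns each product \<open>p q\<close> of the current
  decomposition into two products by the Leibniz rule, and the normal part adds \<open>r\<close> new products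
  \<open>l\<^sub>c (x\<^sub>s) \<partial>\<^sub>c T\<close>. After \<open>k - 1\<close> steps this gives \<open>(2 ^ (k - 1) - 1) r\<close> products with coefficients in the
  function field of \<open>X\<close>, which are specialised at a point where the common denominator does not vanish.
\<close>

section \<open>Polynomial functions and directional derivatives\<close>

text \<open>If the field were finite, the product of all \<open>X - a\<close>, plus 1, would be a
  nonconstant polynomial without roots. Infinitude is what lets a function on a line determine its
  polynomial.\<close>

lemma infinite_UNIV_alg_closed: "infinite (UNIV :: 'a::alg_closed_field set)"
proof
  assume fin: "finite (UNIV :: 'a set)"
  define p :: "'a poly" where "p = (\<Prod>a\<in>UNIV. [:- a, 1:])"
  have deg: "degree p = card (UNIV :: 'a set)"
    unfolding p_def by (subst degree_prod_eq_sum_degree) auto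
  then have "degree p > 0"
    using fin by (simp add: finite_UNIV_card_ge_0)
  then have "degree (p + 1) > 0"
    by (subst degree_add_eq_left) auto
  then obtain x where x: "poly (p + 1) x = 0"
    using alg_closed_imp_poly_has_root by blast
  have "poly p x = 0"
    unfolding p_def poly_prod using fin by (intro prod_zero) (auto intro!: bexI[of _ x])
  then show False
    using x by simp
qed

lemma poly_eqI_alg_closed:
  fixes p q :: "'a::alg_closed_field poly"
  assumes "\<And>t. poly p t = poly q t"
  shows "p = q"
proof (rule ccontr)
  assume "p \<noteq> q"
  then have "finite {t. poly (p - q) t = 0}"
    by (intro poly_roots_finite) simp
  then show False
    using assms infinite_UNIV_alg_closed[where 'a='a] by simp
qed

lemma poly_fun_cong:
  assumes "f \<in> poly_fun W" "\<And>w. w \<in> W \<Longrightarrow> z w = z' w"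
  shows "f z = f z'"
  using assms(1) by induction (auto simp: assms(2))

lemma poly_fun_mono:
  assumes "f \<in> poly_fun W" "W \<subseteq> W'"
  shows "f \<in> poly_fun W'"
  using assms(1) by induction (use assms(2) in \<open>auto intro: poly_fun.intros\<close>)

lemma poly_fun_cmult: "f \<in> poly_fun W \<Longrightarrow> (\<lambda>x. c * f x) \<in> poly_fun W"
  by (rule pf_mult[OF pf_const])

lemma poly_fun_uminus: "f \<in> poly_fun W \<Longrightarrow> (\<lambda>x. - f x) \<in> poly_fun W"
  using poly_fun_cmult[of f W "-1"] by simp

lemma poly_fun_diff: "f \<in> poly_fun W \<Longrightarrow> g \<in> poly_fun W \<Longrightarrow> (\<lambda>x. f x - g x) \<in> poly_fun W"
  using pf_add[OF _ poly_fun_uminus, of f W g] by simp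

lemma poly_fun_power: "f \<in> poly_fun W \<Longrightarrow> (\<lambda>x. f x ^ n) \<in> poly_fun W"
  by (induction n) (auto intro: poly_fun.intros)

lemma poly_fun_sum:
  assumes "\<And>i. i \<in> I \<Longrightarrow> f i \<in> poly_fun W"
  shows "(\<lambda>x. \<Sum>i\<in>I. f i x) \<in> poly_fun W"
  using assms by (induction I rule: infinite_finite_induct) (auto intro: poly_fun.intros)

lemma poly_fun_sum_list:
  assumes "\<And>i. i \<in> set L \<Longrightarrow> f i \<in> poly_fun W"
  shows "(\<lambda>x. \<Sum>i\<leftarrow>L. f i x) \<in> poly_fun W"
  using assms by (induction L) (auto intro: poly_fun.intros)

lemma poly_fun_compose:
  assumes "f \<in> poly_fun W" "\<And>w. w \<in> W \<Longrightarrow> (\<lambda>x. y x w) \<in> poly_fun V"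
  shows "(\<lambda>x. f (y x)) \<in> poly_fun V"
  using assms(1) by induction (auto intro: poly_fun.intros assms(2))

lemmas poly_fun_intros =
  poly_fun.intros poly_fun_cmult poly_fun_uminus poly_fun_diff poly_fun_power poly_fun_sum
  poly_fun_sum_list

lemma poly_fun_insert_expand:
  fixes f :: "('v \<Rightarrow> 'a::idom) \<Rightarrow> 'a"
  assumes "f \<in> poly_fun (insert t W)"
  obtains e c where "\<And>i. c i \<in> poly_fun W" "\<And>z. f z = (\<Sum>i\<le>e. c i z * z t ^ i)"
proof -
  \<comment> \<open>The clause that \<open>c i\<close> vanishes for \<open>i > e\<close> is carried
    along so that two expansions can be brought to a common length and
    \<open>polynomial_product\<close> applies.\<close>
  have "\<exists>e c. (\<forall>i. c i \<in> poly_fun W) \<and> (\<forall>i>e. c i = (\<lambda>z. 0)) \<and>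
          (\<forall>z. f z = (\<Sum>i\<le>e. c i z * z t ^ i))"
    using assms
  proof induction
    case (pf_const a)
    show ?case
      by (rule exI[of _ 0], rule exI[of _ "\<lambda>i. if i = 0 then \<lambda>z. a else (\<lambda>z. 0)"])
        (auto intro: poly_fun.intros)
  next
    case (pf_var v)
    show ?case
    proof (cases "v = t")
      case True
      then show ?thesis
        by (intro exI[of _ 1] exI[of _ "\<lambda>i. if i = 1 then \<lambda>z. 1 else (\<lambda>z. 0)"])
          (auto intro: poly_fun.intros)
    next
      case False
      with pf_var show ?thesis
        by (intro exI[of _ 0] exI[of _ "\<lambda>i. if i = 0 then \<lambda>z. z v else (\<lambda>z. 0)"])
          (auto intro: poly_fun.intros)
    qed
  next
    case (pf_add f g)
    then obtain e c e' c' where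
      c: "\<And>i. c i \<in> poly_fun W" "\<And>i. i > e \<Longrightarrow> c i = (\<lambda>z. 0)"
         "\<And>z. f z = (\<Sum>i\<le>e. c i z * z t ^ i)" and
      c': "\<And>i. c' i \<in> poly_fun W" "\<And>i. i > e' \<Longrightarrow> c' i = (\<lambda>z. 0)"
         "\<And>z. g z = (\<Sum>i\<le>e'. c' i z * z t ^ i)"
      by blast
    have "f z = (\<Sum>i\<le>e+e'. c i z * z t ^ i)" "g z = (\<Sum>i\<le>e+e'. c' i z * z t ^ i)" for z
      unfolding c(3) c'(3) by (intro sum.mono_neutral_left; auto simp: c(2) c'(2))+
    then show ?case
      by (intro exI[of _ "e + e'"] exI[of _ "\<lambda>i z. c i z + c' i z"])
        (auto simp: c(2) c'(2) sum.distrib algebra_simps intro!: poly_fun.pf_add c(1) c'(1))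
  next
    case (pf_mult f g)
    then obtain e c e' c' where
      c: "\<And>i. c i \<in> poly_fun W" "\<And>i. i > e \<Longrightarrow> c i = (\<lambda>z. 0)"
         "\<And>z. f z = (\<Sum>i\<le>e. c i z * z t ^ i)" and
      c': "\<And>i. c' i \<in> poly_fun W" "\<And>i. i > e' \<Longrightarrow> c' i = (\<lambda>z. 0)"
         "\<And>z. g z = (\<Sum>i\<le>e'. c' i z * z t ^ i)"
      by blast
    have zero: "c k z * c' (i - k) z = 0" if "i > e + e'" for i k z
      using that c(2)[of k] c'(2)[of "i - k"] by (cases "k > e") auto
    have "f z * g z = (\<Sum>r\<le>e + e'. (\<Sum>k\<le>r. c k z * c' (r - k) z) * z t ^ r)" for z
      unfolding c(3) c'(3) by (rule polynomial_product) (simp_all add: c(2) c'(2))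
    then show ?case
      by (intro exI[of _ "e + e'"] exI[of _ "\<lambda>r z. \<Sum>k\<le>r. c k z * c' (r - k) z"])
        (auto simp: zero intro!: poly_fun_sum poly_fun.pf_mult c(1) c'(1))
  qed
  then show thesis
    using that by blast
qed

section \<open>Directional derivatives\<close>

text \<open>A polynomial function carries no chosen formal expression, so the derivative is read off
  from its restriction to the line \<open>z + t * u\<close>, as the linear coefficient in
  \<open>t\<close>. Over an algebraically closed field that polynomial is unique, in every
  characteristic.\<close>

definition dirderiv :: "(('v \<Rightarrow> 'a::field) \<Rightarrow> 'a) \<Rightarrow> ('v \<Rightarrow> 'a) \<Rightarrow> ('v \<Rightarrow> 'a) \<Rightarrow> 'a" where
  "dirderiv f z u = coeff (THE p. \<forall>t. poly p t = f (\<lambda>v. z v + t * u v)) 1"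

lemma dirderiv_eqI:
  fixes f :: "('v \<Rightarrow> 'a::alg_closed_field) \<Rightarrow> 'a"
  assumes "\<And>t. poly p t = f (\<lambda>v. z v + t * u v)"
  shows "dirderiv f z u = coeff p 1"
proof -
  have "(THE p. \<forall>t. poly p t = f (\<lambda>v. z v + t * u v)) = p"
    using assms by (intro the_equality) (auto intro!: poly_eqI_alg_closed)
  then show ?thesis
    by (simp add: dirderiv_def)
qed

lemma poly_fun_line:
  fixes f :: "('v \<Rightarrow> 'a::alg_closed_field) \<Rightarrow> 'a"
  assumes "f \<in> poly_fun W"
  obtains p where "\<And>t. poly p t = f (\<lambda>v. z v + t * u v)" "coeff p 0 = f z" "dirderiv f z u = coeff p 1"
proof -
  have "\<exists>p. \<forall>t. poly p t = f (\<lambda>v. z v + t * u v)"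
    using assms
  proof induction
    case (pf_const c)
    show ?case by (intro exI[of _ "[:c:]"]) simp
  next
    case (pf_var v)
    show ?case by (intro exI[of _ "[:z v, u v:]"]) simp
  next
    case (pf_add f g)
    then obtain p q where "\<forall>t. poly p t = f (\<lambda>v. z v + t * u v)" "\<forall>t. poly q t = g (\<lambda>v. z v + t * u v)"
      by blast
    then show ?case by (intro exI[of _ "p + q"]) simp
  next
    case (pf_mult f g)
    then obtain p q where "\<forall>t. poly p t = f (\<lambda>v. z v + t * u v)" "\<forall>t. poly q t = g (\<lambda>v. z v + t * u v)"
      by blast
    then show ?case by (intro exI[of _ "p * q"]) simp
  qed
  then obtain p where p: "\<And>t. poly p t = f (\<lambda>v. z v + t * u v)"
    by blast
  moreover have "coeff p 0 = f z"
    using p[of 0] by (simp add: poly_0_coeff_0)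
  ultimately show thesis
    using that dirderiv_eqI[of p f z u] by blast
qed

context
  fixes f g :: "('v \<Rightarrow> 'a::alg_closed_field) \<Rightarrow> 'a" and W :: "'v set"
  assumes f: "f \<in> poly_fun W" and g: "g \<in> poly_fun W"
begin

lemma dirderiv_add: "dirderiv (\<lambda>x. f x + g x) z u = dirderiv f z u + dirderiv g z u"
proof -
  obtain p where p: "\<And>t. poly p t = f (\<lambda>v. z v + t * u v)" "dirderiv f z u = coeff p 1"
    using poly_fun_line[OF f] by metis
  obtain q where q: "\<And>t. poly q t = g (\<lambda>v. z v + t * u v)" "dirderiv g z u = coeff q 1"
    using poly_fun_line[OF g] by metis
  show ?thesis
    using dirderiv_eqI[of "p + q" "\<lambda>x. f x + g x" z u] p q by simp
qed

lemma dirderiv_mult: "dirderiv (\<lambda>x. f x * g x) z u = dirderiv f z u * g z + f z * dirderiv g z u"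
proof -
  obtain p where p: "\<And>t. poly p t = f (\<lambda>v. z v + t * u v)" "coeff p 0 = f z" "dirderiv f z u = coeff p 1"
    using poly_fun_line[OF f] by metis
  obtain q where q: "\<And>t. poly q t = g (\<lambda>v. z v + t * u v)" "coeff q 0 = g z" "dirderiv g z u = coeff q 1"
    using poly_fun_line[OF g] by metis
  show ?thesis
    using dirderiv_eqI[of "p * q" "\<lambda>x. f x * g x" z u] p q by (simp add: coeff_mult)
qed

end

lemma dirderiv_const [simp]: "dirderiv (\<lambda>x. c :: 'a::alg_closed_field) z u = 0"
  using dirderiv_eqI[of "[:c:]" "\<lambda>x. c" z u] by simp

lemma dirderiv_var [simp]: "dirderiv (\<lambda>x. x v :: 'a::alg_closed_field) z u = u v"
  using dirderiv_eqI[of "[:z v, u v:]" "\<lambda>x. x v" z u] by simp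

lemma dirderiv_cmult:
  fixes f :: "('v \<Rightarrow> 'a::alg_closed_field) \<Rightarrow> 'a"
  assumes "f \<in> poly_fun W"
  shows "dirderiv (\<lambda>x. c * f x) z u = c * dirderiv f z u"
  using dirderiv_mult[OF pf_const assms, of c z u] by simp

lemma dirderiv_diff:
  fixes f g :: "('v \<Rightarrow> 'a::alg_closed_field) \<Rightarrow> 'a"
  assumes "f \<in> poly_fun W" "g \<in> poly_fun W"
  shows "dirderiv (\<lambda>x. f x - g x) z u = dirderiv f z u - dirderiv g z u"
  using dirderiv_add[OF assms(1) poly_fun_cmult[OF assms(2), of "-1"], of z u]
    dirderiv_cmult[OF assms(2), of "-1" z u] by simp

lemma dirderiv_sum_list:
  fixes f :: "'i \<Rightarrow> ('v \<Rightarrow> 'a::alg_closed_field) \<Rightarrow> 'a"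
  assumes "\<And>i. i \<in> set L \<Longrightarrow> f i \<in> poly_fun W"
  shows "dirderiv (\<lambda>x. \<Sum>i\<leftarrow>L. f i x) z u = (\<Sum>i\<leftarrow>L. dirderiv (f i) z u)"
  using assms
proof (induction L)
  case (Cons i L)
  then show ?case
    using dirderiv_add[of "f i" W "\<lambda>x. \<Sum>i\<leftarrow>L. f i x" z u] by (simp add: poly_fun_sum_list)
qed simp

lemma dirderiv_compose_reindex: "dirderiv (\<lambda>z. f (\<lambda>v. z (r v))) z u = dirderiv f (\<lambda>v. z (r v)) (\<lambda>v. u (r v))"
  by (simp add: dirderiv_def)

lemma dirderiv_cong_dir:
  assumes "f \<in> poly_fun W" "\<And>w. w \<in> W \<Longrightarrow> u w = u' w"
  shows "dirderiv f z u = dirderiv f z u'"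
proof -
  have "f (\<lambda>v. z v + t * u v) = f (\<lambda>v. z v + t * u' v)" for t
    using assms by (intro poly_fun_cong[OF assms(1)]) auto
  then show ?thesis
    by (simp add: dirderiv_def)
qed

lemma dirderiv_zero_dir:
  fixes f :: "('v \<Rightarrow> 'a::alg_closed_field) \<Rightarrow> 'a"
  shows "dirderiv f z (\<lambda>v. 0) = 0"
  using dirderiv_eqI[of "[:f z:]" f z "\<lambda>v. 0"] by simp

lemma dirderiv_linear_dir:
  fixes f :: "('v \<Rightarrow> 'a::alg_closed_field) \<Rightarrow> 'a"
  assumes "f \<in> poly_fun W"
  shows "dirderiv f z (\<lambda>v. a * u v + b * w v) = a * dirderiv f z u + b * dirderiv f z w"
  using assms by induction (auto simp: dirderiv_add dirderiv_mult algebra_simps)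

lemma dirderiv_sum_dir:
  fixes f :: "('v \<Rightarrow> 'a::alg_closed_field) \<Rightarrow> 'a"
  assumes "f \<in> poly_fun W"
  shows "dirderiv f z (\<lambda>v. \<Sum>b\<in>B. c b * U b v) = (\<Sum>b\<in>B. c b * dirderiv f z (U b))"
proof (induction B rule: infinite_finite_induct)
  case (insert b B)
  then show ?case
    using dirderiv_linear_dir[OF assms, of z "c b" "U b" 1 "\<lambda>v. \<Sum>b\<in>B. c b * U b v"] by simp
qed (simp_all add: dirderiv_zero_dir)

lemma poly_fun_dirderiv:
  fixes f :: "('w \<Rightarrow> 'a::alg_closed_field) \<Rightarrow> 'a" and y u :: "('v \<Rightarrow> 'a) \<Rightarrow> 'w \<Rightarrow> 'a"
  assumes "f \<in> poly_fun W" "\<And>w. w \<in> W \<Longrightarrow> (\<lambda>x. y x w) \<in> poly_fun V"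
    "\<And>w. w \<in> W \<Longrightarrow> (\<lambda>x. u x w) \<in> poly_fun V"
  shows "(\<lambda>x. dirderiv f (y x) (u x)) \<in> poly_fun V"
  using assms(1)
proof induction
  case (pf_mult f g)
  then show ?case
    by (simp add: dirderiv_mult[OF pf_mult.hyps] poly_fun_intros poly_fun_compose[of _ W] assms(2))
qed (auto simp: dirderiv_add intro!: poly_fun_intros assms(3))

section \<open>Tangent vector fields\<close>

text \<open>The polynomial functions on \<open>X\<close> form an integral domain. This is the form
  in which irreducibility enters the linear algebra over these functions.\<close>

locale domain_pts =
  fixes V :: "'v set" and X :: "('v \<Rightarrow> 'a::alg_closed_field) set"
  assumes nonempty: "X \<noteq> {}"
    and no_zero_divisors: "\<lbrakk>f \<in> poly_fun V; g \<in> poly_fun V; \<forall>x\<in>X. f x * g x = 0\<rbrakk>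
      \<Longrightarrow> (\<forall>x\<in>X. f x = 0) \<or> (\<forall>x\<in>X. g x = 0)"
begin

lemma mult_nonzero:
  assumes "f \<in> poly_fun V" "g \<in> poly_fun V" "\<exists>x\<in>X. f x \<noteq> 0" "\<exists>x\<in>X. g x \<noteq> 0"
  shows "\<exists>x\<in>X. f x * g x \<noteq> 0"
  using no_zero_divisors[OF assms(1,2)] assms(3,4) by blast

text \<open>For coordinate functions \<open>y\<close> indexed by \<open>W\<close>, the vector field \<open>u\<close> induces a derivation from
  \<open>K[y]\<close>, viewed as functions on \<open>X\<close>, into the functions on \<open>X\<close>.\<close>

definition tangent :: "(('v \<Rightarrow> 'a) \<Rightarrow> 'w \<Rightarrow> 'a) \<Rightarrow> 'w set \<Rightarrow> (('v \<Rightarrow> 'a) \<Rightarrow> 'w \<Rightarrow> 'a) \<Rightarrow> bool" where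
  "tangent y W u \<longleftrightarrow> (\<forall>P\<in>poly_fun W. (\<forall>x\<in>X. P (y x) = 0) \<longrightarrow> (\<forall>x\<in>X. dirderiv P (y x) (u x) = 0))"

lemma tangentD: "\<lbrakk>tangent y W u; P \<in> poly_fun W; \<And>x. x \<in> X \<Longrightarrow> P (y x) = 0; x \<in> X\<rbrakk> \<Longrightarrow> dirderiv P (y x) (u x) = 0"
  by (auto simp: tangent_def)

lemma tangent_combine:
  assumes "tangent y W u" "tangent y W u'"
  shows "tangent y W (\<lambda>x w. a x * u x w + b x * u' x w)"
  using assms by (auto simp: tangent_def dirderiv_linear_dir)

lemma tangent_cong:
  assumes "tangent y W u" "\<And>x w. w \<in> W \<Longrightarrow> u x w = u' x w"
  shows "tangent y W u'"
proof -
  have "dirderiv P (y x) (u x) = dirderiv P (y x) (u' x)" if "P \<in> poly_fun W" for P x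
    using dirderiv_cong_dir[OF that] assms(2) by blast
  with assms(1) show ?thesis
    by (simp add: tangent_def)
qed

lemma tangent_zero: "tangent y W (\<lambda>x w. 0)"
  by (simp add: tangent_def dirderiv_zero_dir)

text \<open>Adjoining one more function \<open>t\<close> costs at most one linear equation: either \<open>t\<close> satisfies no relation,
  or every relation for \<open>t\<close> is, up to a nonzero factor, a multiple of one of minimal degree.\<close>

lemma tangent_insert:
  fixes y :: "('v \<Rightarrow> 'a) \<Rightarrow> 'w \<Rightarrow> 'a"
  assumes y: "\<And>w. w \<in> insert t W \<Longrightarrow> (\<lambda>x. y x w) \<in> poly_fun V"
  obtains P where "P \<in> poly_fun (insert t W)"
    "\<And>u. \<lbrakk>\<And>w. w \<in> insert t W \<Longrightarrow> (\<lambda>x. u x w) \<in> poly_fun V; tangent y W u;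
        \<And>x. x \<in> X \<Longrightarrow> dirderiv P (y x) (u x) = 0\<rbrakk> \<Longrightarrow> tangent y (insert t W) u"
proof -
  define Q where "Q e c = (\<lambda>z. \<Sum>i\<le>e. c i z * z t ^ i)" for e :: nat and c :: "nat \<Rightarrow> ('w \<Rightarrow> 'a) \<Rightarrow> 'a"
  define rel where "rel e c \<longleftrightarrow> (\<forall>i. c i \<in> poly_fun W) \<and> (\<forall>x\<in>X. Q e c (y x) = 0)" for e c
  \<comment> \<open>A coefficient counts as zero when it vanishes on \<open>X\<close>, since only
    functions on \<open>X\<close> matter.\<close>
  define nontriv where "nontriv e c \<longleftrightarrow> rel e c \<and> (\<exists>x\<in>X. c e (y x) \<noteq> 0)" for e c
  have mono: "f \<in> poly_fun (insert t W)" if "f \<in> poly_fun W" for f :: "('w \<Rightarrow> 'a) \<Rightarrow> 'a"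
    using that by (rule poly_fun_mono) auto
  have tvar: "(\<lambda>z. z t) \<in> poly_fun (insert t W)"
    by (rule pf_var) auto
  have Qpf: "Q e c \<in> poly_fun (insert t W)" if "\<And>i. c i \<in> poly_fun W" for e c
    unfolding Q_def by (intro poly_fun_sum pf_mult poly_fun_power tvar mono[OF that])
  have QSuc: "Q (Suc f) q z = Q f q z + q (Suc f) z * z t ^ Suc f" for f q z
    by (simp add: Q_def)
  have finish: "tangent y (insert t W) u"
    if *: "\<And>f q x. rel f q \<Longrightarrow> x \<in> X \<Longrightarrow> dirderiv (Q f q) (y x) (u x) = 0" for u
    unfolding tangent_def
  proof (intro ballI impI)
    fix P x
    assume P: "P \<in> poly_fun (insert t W)" "\<forall>x\<in>X. P (y x) = 0" and x: "x \<in> X"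
    obtain e c where c: "\<And>i. c i \<in> poly_fun W" "\<And>z. P z = (\<Sum>i\<le>e. c i z * z t ^ i)"
      by (rule poly_fun_insert_expand[OF P(1)]) blast
    have "P = Q e c"
      unfolding Q_def using c(2) by (intro ext)
    then show "dirderiv P (y x) (u x) = 0"
      using * x P(2) c(1) by (simp add: rel_def)
  qed
  \<comment> \<open>A top coefficient vanishing on \<open>X\<close> is itself a relation over
    \<open>W\<close>, so \<open>u\<close> kills it. By the Leibniz rule the whole top term has zero
    derivative on \<open>X\<close>, and the degree can be lowered.\<close>
  have drop: "dirderiv (Q f q) (y x) (u x) = 0"
    if u: "tangent y W u" and q: "rel f q" and top: "\<forall>x\<in>X. q f (y x) = 0" and x: "x \<in> X"
      and IH: "\<And>f'. f = Suc f' \<Longrightarrow> rel f' q \<Longrightarrow> dirderiv (Q f' q) (y x) (u x) = 0" for f q u x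
  proof -
    have qp: "\<And>i. q i \<in> poly_fun W"
      using q by (auto simp: rel_def)
    have topd: "dirderiv (q f) (y x) (u x) = 0"
      using tangentD[OF u qp _ x] top by blast
    show ?thesis
    proof (cases f)
      case 0
      then have "Q f q = q f"
        by (simp add: Q_def fun_eq_iff)
      with topd show ?thesis by simp
    next
      case (Suc f')
      have "Q f q = (\<lambda>z. Q f' q z + q f z * z t ^ f)"
        using QSuc Suc by (intro ext) simp
      moreover have "rel f' q"
        using q top by (auto simp: rel_def Suc QSuc)
      ultimately show ?thesis
        using IH[OF Suc] topd top x
        by (simp add: dirderiv_add[OF Qpf[OF qp] pf_mult[OF mono[OF qp] poly_fun_power[OF tvar]]]
            dirderiv_mult[OF mono[OF qp] poly_fun_power[OF tvar]])
    qed
  qed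
  show thesis
  proof (cases "\<exists>e c. nontriv e c")
    \<comment> \<open>Without a nontrivial relation \<open>drop\<close> applies in every degree, so
      \<open>u\<close> meets no condition and \<open>P\<close> may be a constant.\<close>
    case False
    have "tangent y (insert t W) u" if u: "tangent y W u" for u
    proof (rule finish)
      fix f q x assume "rel f q" "x \<in> X"
      then show "dirderiv (Q f q) (y x) (u x) = 0"
      proof (induction f)
        case (Suc f)
        show ?case
          by (rule drop[OF u Suc.prems(1)]) (use False Suc in \<open>auto simp: nontriv_def\<close>)
      qed (rule drop[OF u], use False in \<open>auto simp: nontriv_def\<close>)
    qed
    then show thesis
      using that[OF pf_const] by blast
  next
    case True
    define e where "e = (LEAST e. \<exists>c. nontriv e c)"
    obtain c where c: "nontriv e c"
      using True LeastI_ex[of "\<lambda>e. \<exists>c. nontriv e c"] unfolding e_def by blast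
    have min: "e \<le> f" if "nontriv f q" for f q
      unfolding e_def using that by (auto intro: Least_le)
    have cp: "\<And>i. c i \<in> poly_fun W" and cX: "\<And>x. x \<in> X \<Longrightarrow> Q e c (y x) = 0"
      and ce: "\<exists>x\<in>X. c e (y x) \<noteq> 0"
      using c by (auto simp: nontriv_def rel_def)
    \<comment> \<open>In degree 0 the relation would say that its own leading coefficient vanishes
      on \<open>X\<close>.\<close>
    have "e \<noteq> 0"
    proof
      assume "e = 0"
      then have "c e (y x) = 0" if "x \<in> X" for x
        using cX[OF that] by (simp add: Q_def)
      with ce show False by blast
    qed
    have "tangent y (insert t W) u"
      if up: "\<And>w. w \<in> insert t W \<Longrightarrow> (\<lambda>x. u x w) \<in> poly_fun V"
        and u: "tangent y W u" and uc: "\<And>x. x \<in> X \<Longrightarrow> dirderiv (Q e c) (y x) (u x) = 0" for u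
    proof (rule finish)
      fix f q x assume "rel f q" "x \<in> X"
      then show "dirderiv (Q f q) (y x) (u x) = 0"
      proof (induction f arbitrary: q x)
        case 0
        then have "\<not> nontriv 0 q"
          using min \<open>e \<noteq> 0\<close> by fastforce
        with 0 show ?case
          by - (rule drop[OF u 0(1)], auto simp: nontriv_def)
      next
        case (Suc f)
        have qp: "\<And>i. q i \<in> poly_fun W" and qX: "\<And>x. x \<in> X \<Longrightarrow> Q (Suc f) q (y x) = 0"
          using Suc.prems by (auto simp: rel_def)
        show ?case
        proof (cases "nontriv (Suc f) q")
          case False
          then show ?thesis
            by - (rule drop[OF u Suc.prems(1)], use Suc in \<open>auto simp: nontriv_def\<close>)
        next
          case True
          define h where "h = Suc f - e"
          have h: "Suc f = h + e"
            using min[OF True] by (simp add: h_def)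
          \<comment> \<open>Pseudo-division: multiplying \<open>q\<close> by the leading coefficient
            \<open>c e\<close> and subtracting a multiple of the minimal relation cancels the term
            of degree \<open>Suc f\<close> without any division of functions.\<close>
          define r where "r i z = c e z * q i z - (if i < h then 0 else q (Suc f) z * c (i - h) z)" for i z
          have rp: "r i \<in> poly_fun W" for i
            unfolding r_def by (cases "i < h") (auto intro!: poly_fun_intros cp qp)
          have shift: "(\<Sum>i\<le>h + e. (if i < h then 0 else q (Suc f) z * c (i - h) z) * z t ^ i)
              = q (Suc f) z * z t ^ h * Q e c z" for z
          proof -
            have "(\<Sum>i\<le>h + e. (if i < h then 0 else q (Suc f) z * c (i - h) z) * z t ^ i)
              = (\<Sum>i\<in>{h..h+e}. q (Suc f) z * c (i - h) z * z t ^ i)"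
              by (intro sum.mono_neutral_cong_right) auto
            also have "\<dots> = (\<Sum>i\<in>{..e}. q (Suc f) z * c i z * z t ^ (i + h))"
              by (rule sum.reindex_bij_witness[of _ "\<lambda>i. i + h" "\<lambda>i. i - h"]) auto
            finally show ?thesis
              by (simp add: Q_def sum_distrib_left power_add mult_ac)
          qed
          have "Q (Suc f) r z = c e z * Q (Suc f) q z - q (Suc f) z * z t ^ h * Q e c z" for z
            using shift[of z] unfolding Q_def r_def h left_diff_distrib sum_subtractf
            by (simp add: sum_distrib_left mult.assoc)
          moreover have "r (Suc f) z = 0" for z
            by (simp add: r_def h)
          ultimately have Qr: "Q f r = (\<lambda>z. c e z * Q (Suc f) q z - q (Suc f) z * z t ^ h * Q e c z)"
            by (intro ext) (simp add: QSuc)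
          have "rel f r"
            using rp qX cX by (auto simp: rel_def Qr)
          then have IH: "dirderiv (Q f r) (y x) (u x) = 0" if "x \<in> X" for x
            using Suc.IH that by blast
          have p1: "(\<lambda>z. q (Suc f) z * z t ^ h) \<in> poly_fun (insert t W)"
            by (intro pf_mult poly_fun_power tvar mono[OF qp])
          \<comment> \<open>On \<open>X\<close> both relations vanish, and so does the derivative of
            the minimal one. The Leibniz rule leaves only \<open>c e\<close> times the wanted
            derivative, and \<open>c e\<close> is then cancelled in the domain.\<close>
          have prod: "c e (y x) * dirderiv (Q (Suc f) q) (y x) (u x) = 0" if "x \<in> X" for x
            using IH[OF that] qX[OF that] cX[OF that] uc[OF that] unfolding Qr
            by (simp add: dirderiv_diff[OF pf_mult[OF mono[OF cp] Qpf[OF qp]] pf_mult[OF p1 Qpf[OF cp]]]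
                dirderiv_mult[OF mono[OF cp] Qpf[OF qp]] dirderiv_mult[OF p1 Qpf[OF cp]])
          have "(\<lambda>x. c e (y x)) \<in> poly_fun V"
            by (rule poly_fun_compose[OF mono[OF cp] y])
          moreover have "(\<lambda>x. dirderiv (Q (Suc f) q) (y x) (u x)) \<in> poly_fun V"
            by (rule poly_fun_dirderiv[OF Qpf[OF qp] y up])
          ultimately show ?thesis
            using no_zero_divisors[of "\<lambda>x. c e (y x)"] prod ce Suc.prems(2) by blast
        qed
      qed
    qed
    then show thesis
      by (rule that[OF Qpf[OF cp]])
  qed
qed

text \<open>A family of tangent fields in reduced echelon form, with the pivot \<open>\<Delta>\<close> kept as a common denominator.\<close>

definition pivots :: "(('v \<Rightarrow> 'a) \<Rightarrow> 'w \<Rightarrow> 'a) \<Rightarrow> 'w set \<Rightarrow> 'w set \<Rightarrow> (('v \<Rightarrow> 'a) \<Rightarrow> 'a) \<Rightarrow>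
    ('w \<Rightarrow> ('v \<Rightarrow> 'a) \<Rightarrow> 'w \<Rightarrow> 'a) \<Rightarrow> bool" where
  "pivots y W B \<Delta> U \<longleftrightarrow> B \<subseteq> W \<and> \<Delta> \<in> poly_fun V \<and> (\<exists>x\<in>X. \<Delta> x \<noteq> 0) \<and>
     (\<forall>b\<in>B. (\<forall>w\<in>W. (\<lambda>x. U b x w) \<in> poly_fun V) \<and> tangent y W (U b) \<and>
            (\<forall>c\<in>B. \<forall>x\<in>X. U b x c = (if b = c then \<Delta> x else 0)))"

text \<open>Independence of the functions indexed by \<open>W0\<close> makes every field on them
  tangent, so the unit fields give \<open>card W0\<close> pivots. Each further function adds one
  free direction and, by \<open>tangent_insert\<close>, at most one linear condition, so the number
  of pivots never drops.\<close>

lemma pivots_exist: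
  fixes y :: "('v \<Rightarrow> 'a) \<Rightarrow> 'w \<Rightarrow> 'a"
  assumes fin: "finite W0" "finite W1" and disj: "W0 \<inter> W1 = {}"
    and y: "\<And>w. w \<in> W0 \<union> W1 \<Longrightarrow> (\<lambda>x. y x w) \<in> poly_fun V"
    and indep: "\<And>P z. P \<in> poly_fun W0 \<Longrightarrow> (\<And>x. x \<in> X \<Longrightarrow> P (y x) = 0) \<Longrightarrow> P z = 0"
  shows "\<exists>B \<Delta> U. pivots y (W0 \<union> W1) B \<Delta> U \<and> card W0 \<le> card B"
  using fin(2) disj y
proof (induction W1 rule: finite_induct)
  case empty
  have "tangent y W0 u" for u
    unfolding tangent_def
  proof (intro ballI impI)
    fix P x assume "P \<in> poly_fun W0" "\<forall>x\<in>X. P (y x) = 0"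
    then have "P = (\<lambda>z. 0)"
      using indep by blast
    then show "dirderiv P (y x) (u x) = 0"
      by simp
  qed
  then have "pivots y (W0 \<union> {}) W0 (\<lambda>x. 1) (\<lambda>b x w. if b = w then 1 else 0)"
    using nonempty by (auto simp: pivots_def intro: pf_const)
  then show ?case
    by blast
next
  case (insert t W1)
  define W where "W = W0 \<union> W1"
  have W': "W0 \<union> insert t W1 = insert t W"
    by (auto simp: W_def)
  have tW: "t \<notin> W" and finW: "finite W"
    using insert fin by (auto simp: W_def)
  have y': "(\<lambda>x. y x w) \<in> poly_fun V" if "w \<in> insert t W" for w
    using insert.prems that by (auto simp: W_def)
  obtain B \<Delta> U where piv: "pivots y W B \<Delta> U" and card: "card W0 \<le> card B"
    using insert unfolding W_def by auto
  have BW: "B \<subseteq> W" and \<Delta>: "\<Delta> \<in> poly_fun V" "\<exists>x\<in>X. \<Delta> x \<noteq> 0"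
    and U: "\<And>b w. b \<in> B \<Longrightarrow> w \<in> W \<Longrightarrow> (\<lambda>x. U b x w) \<in> poly_fun V"
      "\<And>b. b \<in> B \<Longrightarrow> tangent y W (U b)"
      "\<And>b c x. b \<in> B \<Longrightarrow> c \<in> B \<Longrightarrow> x \<in> X \<Longrightarrow> U b x c = (if b = c then \<Delta> x else 0)"
    using piv unfolding pivots_def by blast+
  have finB: "finite B" and tB: "t \<notin> B"
    using BW finW tW finite_subset by auto
  define B' where "B' = insert t B"
  \<comment> \<open>The old fields are extended by 0 in the direction \<open>t\<close>, and
    \<open>\<Delta>\<close> times the unit vector at \<open>t\<close> is added. The added field is
    zero on \<open>W\<close>, hence tangent there.\<close>
  define U' where "U' b x w = (if b = t then (if w = t then \<Delta> x else 0) else if w = t then 0 else U b x w)"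
    for b x w
  have U'1: "(\<lambda>x. U' b x w) \<in> poly_fun V" if "b \<in> B'" "w \<in> insert t W" for b w
    using that U(1) \<Delta>(1) tB
    by (cases "b = t"; cases "w = t") (auto simp: U'_def B'_def intro: pf_const)
  have U'2: "tangent y W (U' b)" if "b \<in> B'" for b
  proof (cases "b = t")
    case True
    then show ?thesis
      using tW by (intro tangent_cong[OF tangent_zero]) (auto simp: U'_def)
  next
    case False
    then show ?thesis
      using tW that by (intro tangent_cong[OF U(2)]) (auto simp: U'_def B'_def)
  qed
  have U'3: "U' b x c = (if b = c then \<Delta> x else 0)" if "b \<in> B'" "c \<in> B'" "x \<in> X" for b c x
    using that U(3) tB by (auto simp: U'_def B'_def)
  obtain P where P: "P \<in> poly_fun (insert t W)"
    and ext: "\<And>u. \<lbrakk>\<And>w. w \<in> insert t W \<Longrightarrow> (\<lambda>x. u x w) \<in> poly_fun V; tangent y W u;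
        \<And>x. x \<in> X \<Longrightarrow> dirderiv P (y x) (u x) = 0\<rbrakk> \<Longrightarrow> tangent y (insert t W) u"
    using tangent_insert[of t W y] y' by metis
  define \<phi> where "\<phi> b x = dirderiv P (y x) (U' b x)" for b x
  have \<phi>p: "\<phi> b \<in> poly_fun V" if "b \<in> B'" for b
    unfolding \<phi>_def using poly_fun_dirderiv[OF P] y' U'1[OF that] by blast
  show ?case
  proof (cases "\<forall>b\<in>B'. \<forall>x\<in>X. \<phi> b x = 0")
    case True
    have "pivots y (insert t W) B' \<Delta> U'"
      using BW \<Delta> U'1 U'3 True ext[OF U'1 U'2] by (auto simp: pivots_def \<phi>_def B'_def)
    moreover have "card W0 \<le> card B'"
      using card finB tB by (simp add: B'_def)
    ultimately show ?thesis
      unfolding W' by blast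
  next
    case False
    then obtain b0 where b0: "b0 \<in> B'" "\<exists>x\<in>X. \<phi> b0 x \<noteq> 0"
      by blast
    \<comment> \<open>Elimination by cross-multiplication: each combination has derivative zero on
      \<open>P\<close>, the pivot \<open>b0\<close> is given up, and
      \<open>\<Delta> x * \<phi> b0 x\<close> becomes the common denominator.\<close>
    define U'' where "U'' b x w = \<phi> b0 x * U' b x w + (- \<phi> b x) * U' b0 x w" for b x w
    have U''1: "(\<lambda>x. U'' b x w) \<in> poly_fun V" if "b \<in> B'" "w \<in> insert t W" for b w
      unfolding U''_def using that b0 by (intro poly_fun_intros \<phi>p U'1) auto
    have U''2: "tangent y W (U'' b)" if "b \<in> B'" for b
      unfolding U''_def by (intro tangent_combine U'2 that b0(1))
    have "dirderiv P (y x) (U'' b x) = 0" if "b \<in> B'" for b x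
      unfolding U''_def by (subst dirderiv_linear_dir[OF P]) (simp add: \<phi>_def)
    then have U''3: "tangent y (insert t W) (U'' b)" if "b \<in> B'" for b
      using ext[OF U''1 U''2] that by blast
    have "pivots y (insert t W) (B' - {b0}) (\<lambda>x. \<Delta> x * \<phi> b0 x) U''"
      using BW \<Delta> \<phi>p[OF b0(1)] mult_nonzero[OF \<Delta>(1) \<phi>p[OF b0(1)] \<Delta>(2) b0(2)] U''1 U''3 U'3 b0(1)
      by (auto simp: pivots_def U''_def B'_def intro: pf_mult)
    moreover have "card W0 \<le> card (B' - {b0})"
      using card finB tB b0(1) by (simp add: B'_def)
    ultimately show ?thesis
      unfolding W' by blast
  qed
qed

end
section \<open>Chains of irreducible sets\<close>

lemma zariski_closed_zero_set: "f \<in> poly_fun V \<Longrightarrow> zariski_closed V {x \<in> pt_space V. f x = 0}"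
  unfolding zariski_closed_def by (intro exI[of _ "{f}"]) auto

lemma zariski_irreducible_subset_pt_space: "zariski_irreducible V Z \<Longrightarrow> Z \<subseteq> pt_space V"
  by (auto simp: zariski_irreducible_def zariski_closed_def)

lemma zariski_irreducible_domain_pts:
  assumes "zariski_irreducible V Z"
  shows "domain_pts V Z"
proof
  show "Z \<noteq> {}"
    using assms by (simp add: zariski_irreducible_def)
next
  fix f g assume fg: "f \<in> poly_fun V" "g \<in> poly_fun V" "\<forall>x\<in>Z. f x * g x = 0"
  let ?A = "\<lambda>f. {x \<in> pt_space V. f x = 0}"
  have "Z \<subseteq> ?A f \<union> ?A g"
    using fg(3) zariski_irreducible_subset_pt_space[OF assms] by auto
  then have "Z \<subseteq> ?A f \<or> Z \<subseteq> ?A g"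
    using assms zariski_closed_zero_set fg(1,2) unfolding zariski_irreducible_def by blast
  then show "(\<forall>x\<in>Z. f x = 0) \<or> (\<forall>x\<in>Z. g x = 0)"
    by blast
qed

lemma zariski_irreducible_singleton:
  assumes "x \<in> pt_space V"
  shows "zariski_irreducible V {x}"
proof -
  have "(\<lambda>z. z v - x v) \<in> poly_fun V" if "v \<in> V" for v
    by (intro poly_fun_diff pf_var pf_const that)
  moreover have "{x} = {z \<in> pt_space V. \<forall>f\<in>(\<lambda>v z. z v - x v) ` V. f z = 0}"
    using assms by (auto simp: pt_space_def fun_eq_iff) metis
  ultimately have "zariski_closed V {x}"
    unfolding zariski_closed_def by (intro exI[of _ "(\<lambda>v z. z v - x v) ` V"]) blast
  then show ?thesis
    by (auto simp: zariski_irreducible_def)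
qed

lemma zariski_closed_separate:
  assumes "zariski_closed V A" "x \<in> pt_space V" "x \<notin> A"
  obtains f where "f \<in> poly_fun V" "\<And>a. a \<in> A \<Longrightarrow> f a = 0" "f x \<noteq> 0"
  using assms unfolding zariski_closed_def by blast

text \<open>Induction along the chain: a relation on \<open>C (Suc j)\<close> is expanded in powers
  of \<open>g j\<close>, which vanishes on \<open>C j\<close> but not on \<open>C (Suc j)\<close>,
  and its coefficients die one after another by independence on \<open>C j\<close>. The length of a
  chain thus bounds the transcendence degree from below.\<close>

lemma chain_algebraically_independent:
  fixes C :: "nat \<Rightarrow> ('v \<Rightarrow> 'a::alg_closed_field) set"
  assumes irr: "\<And>i. i \<le> m \<Longrightarrow> zariski_irreducible V (C i)"
    and sub: "\<And>i. i < m \<Longrightarrow> C i \<subseteq> C (Suc i)"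
    and g: "\<And>i. i < m \<Longrightarrow> g i \<in> poly_fun V"
    and g0: "\<And>i x. i < m \<Longrightarrow> x \<in> C i \<Longrightarrow> g i x = 0"
    and g1: "\<And>i. i < m \<Longrightarrow> \<exists>x\<in>C (Suc i). g i x \<noteq> 0"
    and "j \<le> m" "P \<in> poly_fun {..<j}" "\<And>x. x \<in> C j \<Longrightarrow> P (\<lambda>i. g i x) = 0"
  shows "P z = 0"
  using assms(6-8)
proof (induction j arbitrary: P z)
  case 0
  obtain x where "x \<in> C 0"
    using irr[of 0] by (auto simp: zariski_irreducible_def)
  moreover have "P z = P (\<lambda>i. g i x)"
    by (rule poly_fun_cong[OF 0(2)]) simp
  ultimately show ?case
    using 0 by simp
next
  case (Suc j)
  have j: "j < m"
    using Suc.prems by simp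
  interpret domain_pts V "C (Suc j)"
    by (rule zariski_irreducible_domain_pts[OF irr[OF Suc.prems(1)]])
  have "P \<in> poly_fun (insert j {..<j})"
    using Suc.prems(2) by (simp add: lessThan_Suc)
  then obtain e c where c: "\<And>i. c i \<in> poly_fun {..<j}" and P: "\<And>z. P z = (\<Sum>i\<le>e. c i z * z j ^ i)"
    by (rule poly_fun_insert_expand) blast
  have cV: "(\<lambda>x. c i (\<lambda>l. g l x)) \<in> poly_fun V" if "\<And>i. c i \<in> poly_fun {..<j}" for c i
    using j by (intro poly_fun_compose[OF that] g) auto
  have outer: "c z = 0" if "c \<in> poly_fun {..<j}" "\<And>x. x \<in> C j \<Longrightarrow> c (\<lambda>i. g i x) = 0" for c z
    using Suc.IH[OF _ that] j by simp
  \<comment> \<open>Restricting a relation to \<open>C j\<close> kills its constant coefficient, after which \<open>g j\<close> can be cancelled.\<close>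
  have "\<forall>i\<le>e. \<forall>z. c i z = 0"
    if "\<And>i. c i \<in> poly_fun {..<j}" "\<And>x. x \<in> C (Suc j) \<Longrightarrow> (\<Sum>i\<le>e. c i (\<lambda>l. g l x) * g j x ^ i) = 0" for e c
    using that
  proof (induction e arbitrary: c)
    case 0
    have "c 0 (\<lambda>i. g i x) = 0" if "x \<in> C j" for x
      using 0(2)[of x] sub[OF j] that by auto
    then have "c 0 z = 0" for z
      by (rule outer[OF 0(1)])
    then show ?case by simp
  next
    case (Suc e)
    have split: "(\<Sum>i\<le>Suc e. c i (\<lambda>l. g l x) * g j x ^ i)
        = c 0 (\<lambda>l. g l x) + g j x * (\<Sum>i\<le>e. c (Suc i) (\<lambda>l. g l x) * g j x ^ i)" for x
      by (subst sum.atMost_Suc_shift) (simp add: sum_distrib_left mult_ac)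
    have c0: "c 0 z = 0" for z
    proof (rule outer[OF Suc.prems(1)])
      fix x assume x: "x \<in> C j"
      then have "x \<in> C (Suc j)"
        using sub[OF j] by blast
      from Suc.prems(2)[OF this] show "c 0 (\<lambda>l. g l x) = 0"
        unfolding split using g0[OF j x] by simp
    qed
    have "(\<lambda>x. \<Sum>i\<le>e. c (Suc i) (\<lambda>l. g l x) * g j x ^ i) \<in> poly_fun V"
      by (intro poly_fun_sum pf_mult poly_fun_power g[OF j] cV[OF Suc.prems(1)])
    moreover have "\<forall>x\<in>C (Suc j). g j x * (\<Sum>i\<le>e. c (Suc i) (\<lambda>l. g l x) * g j x ^ i) = 0"
      using Suc.prems(2) by (simp only: split c0) simp
    ultimately have "\<forall>x\<in>C (Suc j). (\<Sum>i\<le>e. c (Suc i) (\<lambda>l. g l x) * g j x ^ i) = 0"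
      using no_zero_divisors[OF g[OF j]] g1[OF j] by blast
    then have "\<forall>i\<le>e. \<forall>z. c (Suc i) z = 0"
      by (intro Suc.IH Suc.prems(1)) blast
    with c0 show ?case
      by (metis Suc_le_mono not0_implies_Suc)
  qed
  then have "\<forall>i\<le>e. \<forall>z. c i z = 0"
    using c Suc.prems(3) unfolding P by blast
  then show ?case
    unfolding P by (intro sum.neutral) auto
qed

text \<open>The separating functions are adjoined to the coordinates as additional variables and,
  being independent, yield \<open>m\<close> pivots. A pivot at a separating function can be
  exchanged for one at a genuine coordinate, because the derivative of \<open>g i\<close> is
  determined by those of the coordinates.\<close>

lemma pivots_of_chain:
  fixes C :: "nat \<Rightarrow> ('v \<Rightarrow> 'a::alg_closed_field) set"
  assumes fin: "finite V"
    and irr: "\<And>i. i \<le> m \<Longrightarrow> zariski_irreducible V (C i)"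
    and sub: "\<And>i. i < m \<Longrightarrow> C i \<subset> C (Suc i)"
  shows "\<exists>B \<Delta> U. domain_pts.pivots V (C m) (\<lambda>x. x) V B \<Delta> U \<and> m \<le> card B"
proof -
  interpret domain_pts V "C m"
    by (rule zariski_irreducible_domain_pts[OF irr]) simp
  have "\<exists>f. f \<in> poly_fun V \<and> (\<forall>x\<in>C i. f x = 0) \<and> (\<exists>x\<in>C (Suc i). f x \<noteq> 0)" if i: "i < m" for i
  proof -
    obtain x where "x \<in> C (Suc i)" "x \<notin> C i"
      using sub[OF i] by blast
    moreover have "x \<in> pt_space V"
      using calculation i irr[of "Suc i"] zariski_irreducible_subset_pt_space by fastforce
    ultimately show ?thesis
      using zariski_closed_separate[of V "C i" x] irr[of i] i
      by (metis less_imp_le zariski_irreducible_def)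
  qed
  then obtain g where g: "\<And>i. i < m \<Longrightarrow> g i \<in> poly_fun V"
    and g0: "\<And>i x. i < m \<Longrightarrow> x \<in> C i \<Longrightarrow> g i x = 0"
    and g1: "\<And>i. i < m \<Longrightarrow> \<exists>x\<in>C (Suc i). g i x \<noteq> 0"
    by metis
  \<comment> \<open>\<open>Inl\<close> indexes the separating functions and \<open>Inr\<close> the
    coordinates, so \<open>y\<close> parametrises the graph of the \<open>g i\<close>.\<close>
  define y :: "('v \<Rightarrow> 'a) \<Rightarrow> nat + 'v \<Rightarrow> 'a" where "y x = case_sum (\<lambda>i. g i x) x" for x
  define W where "W = Inl ` {..<m} \<union> Inr ` V"
  have yp: "(\<lambda>x. y x w) \<in> poly_fun V" if "w \<in> W" for w
    using that g by (auto simp: W_def y_def intro: pf_var)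
  have indep: "P z = 0" if P: "P \<in> poly_fun (Inl ` {..<m})" "\<And>x. x \<in> C m \<Longrightarrow> P (y x) = 0" for P z
  proof -
    have P': "(\<lambda>z. P (case_sum z (\<lambda>_. 0))) \<in> poly_fun {..<m}"
      by (rule poly_fun_compose[OF P(1)]) (auto intro: pf_var)
    have eq: "P z = P (case_sum (\<lambda>i. z (Inl i)) (\<lambda>_. 0))" for z
      by (rule poly_fun_cong[OF P(1)]) auto
    have zero: "P (case_sum (\<lambda>i. g i x) (\<lambda>_. 0)) = 0" if "x \<in> C m" for x
      using P(2)[OF that] eq[of "y x"] by (simp add: y_def)
    have "P (case_sum (\<lambda>i. z (Inl i)) (\<lambda>_. 0)) = 0"
      by (rule chain_algebraically_independent[OF irr psubset_imp_subset[OF sub] g g0 g1 order_refl P' zero])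
    with eq show ?thesis
      by simp
  qed
  have "\<exists>B \<Delta> U. pivots y W B \<Delta> U \<and> card (Inl ` {..<m} :: (nat + 'v) set) \<le> card B"
    unfolding W_def
  proof (rule pivots_exist)
    show "(\<lambda>x. y x w) \<in> poly_fun V" if "w \<in> Inl ` {..<m} \<union> Inr ` V" for w
      using yp that by (simp add: W_def)
    show "P z = 0" if "P \<in> poly_fun (Inl ` {..<m})" "\<And>x. x \<in> C m \<Longrightarrow> P (y x) = 0" for P z
      using that by (rule indep)
  qed (use fin in auto)
  then have ex: "\<exists>B \<Delta> U. pivots y W B \<Delta> U \<and> m \<le> card B"
    by (simp add: card_image)
  have swap: "\<exists>B' \<Delta> U. pivots y W B' \<Delta> U \<and> card B' = card B \<and> card (B' \<inter> range Inl) < card (B \<inter> range Inl)"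
    if piv: "pivots y W B \<Delta> U" and i: "Inl i \<in> B" for B \<Delta> U i
  proof -
    have BW: "B \<subseteq> W" and \<Delta>: "\<Delta> \<in> poly_fun V" "\<exists>x\<in>C m. \<Delta> x \<noteq> 0"
      and U: "\<And>b w. b \<in> B \<Longrightarrow> w \<in> W \<Longrightarrow> (\<lambda>x. U b x w) \<in> poly_fun V"
        "\<And>b. b \<in> B \<Longrightarrow> tangent y W (U b)"
        "\<And>b c x. b \<in> B \<Longrightarrow> c \<in> B \<Longrightarrow> x \<in> C m \<Longrightarrow> U b x c = (if b = c then \<Delta> x else 0)"
      using piv unfolding pivots_def by blast+
    have finB: "finite B"
      using BW fin finite_subset unfolding W_def by blast
    have im: "i < m"
      using i BW by (auto simp: W_def)
    have gi: "(\<lambda>z. g i (\<lambda>v. z (Inr v))) \<in> poly_fun W"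
      by (rule poly_fun_compose[OF g[OF im]]) (auto simp: W_def intro: pf_var)
    have vi: "(\<lambda>z. z (Inl i)) \<in> poly_fun W"
      using im by (auto simp: W_def intro: pf_var)
    \<comment> \<open>That the variable \<open>Inl i\<close> equals \<open>g i\<close> of the
      coordinates is a relation on the graph, so a tangent field respects it.\<close>
    have chain_rule: "U (Inl i) x (Inl i) = dirderiv (g i) x (\<lambda>v. U (Inl i) x (Inr v))" if "x \<in> C m" for x
    proof -
      have "dirderiv (\<lambda>z. z (Inl i) - g i (\<lambda>v. z (Inr v))) (y x) (U (Inl i) x) = 0"
        using tangentD[OF U(2)[OF i] poly_fun_diff[OF vi gi] _ that] by (simp add: y_def)
      then show ?thesis
        by (simp add: dirderiv_diff[OF vi gi] dirderiv_compose_reindex[of "g i" Inr]) (simp add: y_def)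
    qed
    \<comment> \<open>Pivot coordinates contribute nothing, by the echelon form. If the others did
      not either, the chain rule would make the component at \<open>Inl i\<close>, which is
      \<open>\<Delta>\<close>, vanish on \<open>C m\<close>.\<close>
    have "\<exists>v\<in>V. Inr v \<notin> B \<and> (\<exists>x\<in>C m. U (Inl i) x (Inr v) \<noteq> 0)"
    proof (rule ccontr)
      assume "\<not> ?thesis"
      then have zero: "U (Inl i) x (Inr v) = 0" if "v \<in> V" "x \<in> C m" for v x
        using that U(3)[OF i, of "Inr v" x] by (cases "Inr v \<in> B") auto
      have "\<Delta> x = 0" if x: "x \<in> C m" for x
      proof -
        have "\<Delta> x = dirderiv (g i) x (\<lambda>v. U (Inl i) x (Inr v))"
          using chain_rule[OF x] U(3)[OF i i x] by simp
        also have "\<dots> = dirderiv (g i) x (\<lambda>v. 0)"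
          using zero x by (intro dirderiv_cong_dir[OF g[OF im]]) auto
        finally show ?thesis
          by (simp add: dirderiv_zero_dir)
      qed
      with \<Delta>(2) show False by blast
    qed
    then obtain v where v: "v \<in> V" "Inr v \<notin> B" "\<exists>x\<in>C m. U (Inl i) x (Inr v) \<noteq> 0"
      by blast
    have vW: "Inr v \<in> W"
      using v(1) by (auto simp: W_def)
    define \<phi> where "\<phi> b x = U b x (Inr v)" for b x
    have \<phi>p: "\<phi> b \<in> poly_fun V" if "b \<in> B" for b
      unfolding \<phi>_def using U(1)[OF that vW] .
    \<comment> \<open>The field of \<open>Inl i\<close> becomes the field of the new pivot
      \<open>Inr v\<close>, and the other fields are cleared there by cross-multiplication. The
      summand with factor 0 only gives the shape of \<open>tangent_combine\<close>.\<close>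
    define U' where "U' b = (if b = Inr v then (\<lambda>x w. \<Delta> x * U (Inl i) x w + 0 * U (Inl i) x w)
        else (\<lambda>x w. \<phi> (Inl i) x * U b x w + (- \<phi> b x) * U (Inl i) x w))" for b
    define B' where "B' = insert (Inr v) (B - {Inl i})"
    have "(\<lambda>x. U' b x w) \<in> poly_fun V" if "b \<in> B'" "w \<in> W" for b w
      using that i \<Delta>(1) U(1) \<phi>p
      by (cases "b = Inr v") (auto simp: U'_def B'_def intro!: pf_add pf_mult poly_fun_diff)
    moreover have "tangent y W (U' b)" if "b \<in> B'" for b
    proof (cases "b = Inr v")
      case True
      show ?thesis
        unfolding U'_def if_P[OF True] by (rule tangent_combine[OF U(2)[OF i] U(2)[OF i]])
    next
      case False
      then have "b \<in> B"
        using that by (auto simp: B'_def)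
      then show ?thesis
        unfolding U'_def if_not_P[OF False] by (intro tangent_combine U(2) i)
    qed
    moreover have "U' b x c = (if b = c then \<Delta> x * \<phi> (Inl i) x else 0)"
      if "b \<in> B'" "c \<in> B'" "x \<in> C m" for b c x
      using that i U(3) v(2) by (auto simp: U'_def B'_def \<phi>_def)
    moreover have "\<exists>x\<in>C m. \<Delta> x * \<phi> (Inl i) x \<noteq> 0"
      using mult_nonzero[OF \<Delta>(1) \<phi>p[OF i] \<Delta>(2)] v(3) by (simp add: \<phi>_def)
    ultimately have "pivots y W B' (\<lambda>x. \<Delta> x * \<phi> (Inl i) x) U'"
      using BW vW \<Delta>(1) \<phi>p[OF i] by (auto simp: pivots_def B'_def intro: pf_mult)
    moreover have "card B' = card B"
      using finB i v(2) card_Suc_Diff1[OF finB i] by (simp add: B'_def del: card_Diff_insert)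
    moreover have "B' \<inter> range Inl \<subset> B \<inter> range Inl"
      using i by (auto simp: B'_def)
    then have "card (B' \<inter> range Inl) < card (B \<inter> range Inl)"
      by (rule psubset_card_mono[OF finite_Int[OF disjI1[OF finB]]])
    ultimately show ?thesis
      by blast
  qed
  have purge: "\<exists>B' \<Delta>' U'. pivots y W B' \<Delta>' U' \<and> card B' = card B \<and> B' \<inter> range Inl = {}"
    if "pivots y W B \<Delta> U" for B \<Delta> U
    using that
  proof (induction "card (B \<inter> range Inl)" arbitrary: B \<Delta> U rule: less_induct)
    case less
    show ?case
    proof (cases "B \<inter> range Inl = {}")
      case False
      then obtain i where "Inl i \<in> B" by blast
      then obtain B' \<Delta>' U' where B': "pivots y W B' \<Delta>' U'" "card B' = card B"
          "card (B' \<inter> range Inl) < card (B \<inter> range Inl)"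
        using swap[OF less.prems] by blast
      show ?thesis
        using less.hyps[OF B'(3,1)] B'(2) by auto
    qed (use less in blast)
  qed
  obtain B1 \<Delta>1 U1 where B1: "pivots y W B1 \<Delta>1 U1" "m \<le> card B1"
    using ex by blast
  then obtain B \<Delta> U where piv: "pivots y W B \<Delta> U" and card: "m \<le> card B" and noInl: "B \<inter> range Inl = {}"
    using purge[OF B1(1)] by auto
  define B0 where "B0 = Inr -` B"
  have B: "B = Inr ` B0"
  proof (intro equalityI subsetI)
    fix w assume "w \<in> B"
    then show "w \<in> Inr ` B0"
      using noInl by (cases w) (auto simp: B0_def)
  qed (auto simp: B0_def)
  have BW: "B \<subseteq> W" and \<Delta>: "\<Delta> \<in> poly_fun V" "\<exists>x\<in>C m. \<Delta> x \<noteq> 0"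
    and U: "\<And>b w. b \<in> B \<Longrightarrow> w \<in> W \<Longrightarrow> (\<lambda>x. U b x w) \<in> poly_fun V"
      "\<And>b. b \<in> B \<Longrightarrow> tangent y W (U b)"
      "\<And>b c x. b \<in> B \<Longrightarrow> c \<in> B \<Longrightarrow> x \<in> C m \<Longrightarrow> U b x c = (if b = c then \<Delta> x else 0)"
    using piv unfolding pivots_def by blast+
  \<comment> \<open>A relation among the coordinates is also a relation on the graph, so forgetting
    the \<open>Inl\<close> components preserves tangency.\<close>
  have tan: "tangent (\<lambda>x. x) V (\<lambda>x v. U b x (Inr v))" if b: "b \<in> B" for b
    unfolding tangent_def
  proof (intro ballI impI)
    fix P x assume P: "P \<in> poly_fun V" "\<forall>x\<in>C m. P x = 0" and x: "x \<in> C m"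
    have "(\<lambda>z. P (\<lambda>v. z (Inr v))) \<in> poly_fun W"
      by (rule poly_fun_compose[OF P(1)]) (auto simp: W_def intro: pf_var)
    then have "dirderiv (\<lambda>z. P (\<lambda>v. z (Inr v))) (y x) (U b x) = 0"
      by (rule tangentD[OF U(2)[OF b] _ _ x]) (use P(2) in \<open>simp add: y_def\<close>)
    then show "dirderiv P x (\<lambda>v. U b x (Inr v)) = 0"
      by (simp add: dirderiv_compose_reindex[of P Inr]) (simp add: y_def)
  qed
  have "pivots (\<lambda>x. x) V B0 \<Delta> (\<lambda>b x v. U (Inr b) x (Inr v))"
    using BW \<Delta> U tan unfolding pivots_def by (auto simp: B W_def)
  moreover have "m \<le> card B0"
    using card by (simp add: B card_image)
  ultimately show ?thesis
    by blast
qed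

section \<open>Multilinear forms\<close>

text \<open>Unlike in \<open>multilinear\<close>, the form is controlled at all arguments and depends on the blocks in \<open>I\<close> only.\<close>

definition mform :: "nat set \<Rightarrow> (nat \<Rightarrow> nat) \<Rightarrow> ((nat \<times> nat \<Rightarrow> 'a::field) \<Rightarrow> 'a) \<Rightarrow> bool" where
  "mform I d p \<longleftrightarrow>
     (\<forall>x. \<forall>i\<in>I. \<forall>v w c. p (setblk d x i (\<lambda>b. c * v b + w b)) = c * p (setblk d x i v) + p (setblk d x i w)) \<and>
     (\<forall>x y. (\<forall>a\<in>I. \<forall>b<d a. x (a, b) = y (a, b)) \<longrightarrow> p x = p y)"

lemma mform_linear:
  "mform I d p \<Longrightarrow> i \<in> I \<Longrightarrow>
    p (setblk d x i (\<lambda>b. c * v b + w b)) = c * p (setblk d x i v) + p (setblk d x i w)"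
  by (simp add: mform_def)

lemma mform_cong: "mform I d p \<Longrightarrow> (\<And>a b. a \<in> I \<Longrightarrow> b < d a \<Longrightarrow> x (a, b) = y (a, b)) \<Longrightarrow> p x = p y"
  by (simp add: mform_def)

lemma mform_multilinear: "mform I d p \<Longrightarrow> multilinear I d p"
  by (simp add: mform_def multilinear_def)

lemma mform_restr: "mform I d p \<Longrightarrow> p (restr x I) = p x"
  by (rule mform_cong) (auto simp: restr_def)

lemma mform_const: "mform {} d (\<lambda>x. c)"
  by (simp add: mform_def)

lemma mform_zero: "mform I d (\<lambda>x. 0)"
  by (simp add: mform_def)

lemma mform_add: "mform I d p \<Longrightarrow> mform I d q \<Longrightarrow> mform I d (\<lambda>x. p x + q x)"
  unfolding mform_def by (simp add: algebra_simps) metis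

lemma mform_cmult: "mform I d p \<Longrightarrow> mform I d (\<lambda>x. c * p x)"
  unfolding mform_def by (simp add: algebra_simps)

lemma mform_diff: "mform I d p \<Longrightarrow> mform I d q \<Longrightarrow> mform I d (\<lambda>x. p x - q x)"
  using mform_add[OF _ mform_cmult[of I d q "-1"], of p] by simp

lemma mform_sum: "(\<And>b. b \<in> B \<Longrightarrow> mform I d (p b)) \<Longrightarrow> mform I d (\<lambda>x. \<Sum>b\<in>B. p b x)"
  by (induction B rule: infinite_finite_induct) (auto intro: mform_zero mform_add)

lemma mform_mult_var:
  assumes p: "mform I d p" and "i \<notin> I" "j < d i"
  shows "mform (insert i I) d (\<lambda>x. x (i, j) * p x)"
proof -
  have indep: "p (setblk d x i v) = p x" for x v
    by (rule mform_cong[OF p]) (use \<open>i \<notin> I\<close> in \<open>auto simp: setblk_def\<close>)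
  have [simp]: "setblk d x i v (i, j) = v j" for x v
    using \<open>j < d i\<close> by (simp add: setblk_def)
  have ne: "setblk d x i' v (i, j) = x (i, j)" if "i' \<in> I" for i' x v
    using that \<open>i \<notin> I\<close> by (auto simp: setblk_def)
  have "x (i, j) * p x = y (i, j) * p y" if "\<forall>a\<in>insert i I. \<forall>b<d a. x (a, b) = y (a, b)" for x y
    using that \<open>j < d i\<close> mform_cong[OF p, of x y] by simp
  then show ?thesis
    unfolding mform_def by (auto simp: indep ne mform_linear[OF p] distrib_left distrib_right mult.assoc mult.left_commute)
qed

lemma mform_dirderiv:
  fixes p :: "('v \<Rightarrow> 'a::alg_closed_field) \<Rightarrow> (nat \<times> nat \<Rightarrow> 'a) \<Rightarrow> 'a"
  assumes p: "\<And>\<xi>. mform I d (p \<xi>)" and poly: "\<And>x. (\<lambda>\<xi>. p \<xi> x) \<in> poly_fun V"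
  shows "mform I d (\<lambda>x. dirderiv (\<lambda>\<xi>. p \<xi> x) z u)"
proof -
  have "dirderiv (\<lambda>\<xi>. p \<xi> (setblk d x i (\<lambda>b. c * v b + w b))) z u
      = c * dirderiv (\<lambda>\<xi>. p \<xi> (setblk d x i v)) z u + dirderiv (\<lambda>\<xi>. p \<xi> (setblk d x i w)) z u"
    if "i \<in> I" for x i v w c
    by (simp add: mform_linear[OF p that] dirderiv_add[OF poly_fun_cmult[OF poly] poly] dirderiv_cmult[OF poly])
  moreover have "dirderiv (\<lambda>\<xi>. p \<xi> x) z u = dirderiv (\<lambda>\<xi>. p \<xi> y) z u"
    if "\<forall>a\<in>I. \<forall>b<d a. x (a, b) = y (a, b)" for x y
  proof -
    have "(\<lambda>\<xi>. p \<xi> x) = (\<lambda>\<xi>. p \<xi> y)"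
      by (intro ext mform_cong[OF p]) (use that in auto)
    then show ?thesis by simp
  qed
  ultimately show ?thesis
    by (simp add: mform_def)
qed

lemma mform_setblk_zero:
  assumes "mform I d p" "i \<in> I"
  shows "p (setblk d x i (\<lambda>b. 0)) = 0"
  using mform_linear[OF assms, of x "-1" "\<lambda>b. 0" "\<lambda>b. 0"] by simp

lemma mform_expand:
  assumes p: "mform I d p" "i \<in> I"
  shows "p (setblk d x i v) = (\<Sum>j<d i. v j * p (setblk d x i (\<lambda>b. if b = j then 1 else 0)))"
proof -
  have exp: "p (setblk d x i (\<lambda>b. \<Sum>j\<in>F. v j * (if b = j then 1 else 0)))
      = (\<Sum>j\<in>F. v j * p (setblk d x i (\<lambda>b. if b = j then 1 else 0)))" if "finite F" for F
    using that
  proof induction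
    case (insert j F)
    then show ?case
      using mform_linear[OF p, of x "v j" "\<lambda>b. if b = j then 1 else 0"
          "\<lambda>b. \<Sum>j\<in>F. v j * (if b = j then 1 else 0)"] by simp
  qed (simp add: mform_setblk_zero[OF p])
  have "setblk d x i (\<lambda>b. \<Sum>j<d i. v j * (if b = j then 1 else 0)) = setblk d x i v"
    by (auto simp: setblk_def fun_eq_iff if_distrib cong: if_cong)
  with exp[OF finite_lessThan, of "d i"] show ?thesis
    by simp
qed

text \<open>\<open>multilinear\<close> says nothing about arguments outside the coordinate space.
  Truncating first turns \<open>T\<close> into an \<open>mform\<close> that agrees with it on that
  space.\<close>

definition trunc_pt :: "nat \<Rightarrow> (nat \<Rightarrow> nat) \<Rightarrow> (nat \<times> nat \<Rightarrow> 'a::zero) \<Rightarrow> nat \<times> nat \<Rightarrow> 'a" where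
  "trunc_pt k d x = (\<lambda>(a, b). if a < k \<and> b < d a then x (a, b) else 0)"

lemma trunc_pt_eq: "x \<in> pt_space (blockvars {..<k} d) \<Longrightarrow> trunc_pt k d x = x"
  by (auto simp: trunc_pt_def pt_space_def blockvars_def fun_eq_iff)

lemma multilinear_trunc_mform:
  assumes "multilinear {..<k} d T"
  shows "mform {..<k} d (\<lambda>x. T (trunc_pt k d x))"
proof -
  have "trunc_pt k d (setblk d x i v) = setblk d (trunc_pt k d x) i v" if "i < k" for x :: "nat \<times> nat \<Rightarrow> 'a" and i v
    using that by (auto simp: trunc_pt_def setblk_def fun_eq_iff)
  moreover have "trunc_pt k d x \<in> pt_space (blockvars {..<k} d)" for x :: "nat \<times> nat \<Rightarrow> 'a"
    by (auto simp: trunc_pt_def pt_space_def blockvars_def)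
  moreover have "trunc_pt k d x = trunc_pt k d y" if "\<forall>a\<in>{..<k}. \<forall>b<d a. x (a, b) = y (a, b)"
    for x y :: "nat \<times> nat \<Rightarrow> 'a"
    using that by (auto simp: trunc_pt_def fun_eq_iff)
  ultimately show ?thesis
    using assms by (auto simp: mform_def multilinear_def) metis
qed

section \<open>Substituting the base point into the form\<close>

text \<open>\<open>s\<close> counts the blocks already freed by differentiation. For
  \<open>s = 0\<close> the form sees the base point and the last block \<open>n\<close> of
  \<open>x\<close>, hence vanishes over the kernel; for \<open>s = n\<close> it sees
  \<open>x\<close> alone.\<close>

definition mix :: "nat \<Rightarrow> nat \<Rightarrow> (nat \<times> nat \<Rightarrow> 'a) \<Rightarrow> (nat \<times> nat \<Rightarrow> 'a) \<Rightarrow> nat \<times> nat \<Rightarrow> 'a" where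
  "mix s n x \<xi> = (\<lambda>(a, b). if s \<le> a \<and> a < n then \<xi> (a, b) else x (a, b))"

lemma mix_self [simp]: "mix n n x \<xi> = x"
  by (auto simp: mix_def fun_eq_iff)

context
  fixes n :: nat and d :: "nat \<Rightarrow> nat" and T :: "(nat \<times> nat \<Rightarrow> 'a::alg_closed_field) \<Rightarrow> 'a"
  assumes T: "mform {..<Suc n} d T"
begin

lemma mform_mix:
  assumes "s \<le> n"
  shows "mform ({..<s} \<union> {n}) d (\<lambda>x. T (mix s n x \<xi>))"
proof -
  have eq: "mix s n (setblk d x i v) \<xi> = setblk d (mix s n x \<xi>) i v" if "i \<in> {..<s} \<union> {n}" for x i v
    using that assms by (auto simp: mix_def setblk_def fun_eq_iff)
  have lin: "T (setblk d x i (\<lambda>b. c * v b + w b)) = c * T (setblk d x i v) + T (setblk d x i w)"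
    if "i \<in> {..<s} \<union> {n}" for x i c v w
    by (rule mform_linear[OF T]) (use that assms in auto)
  have "T (mix s n x \<xi>) = T (mix s n y \<xi>)" if "\<forall>a\<in>{..<s} \<union> {n}. \<forall>b<d a. x (a, b) = y (a, b)" for x y
    by (rule mform_cong[OF T]) (use that in \<open>auto simp: mix_def less_Suc_eq\<close>)
  then show ?thesis
    unfolding mform_def using eq lin by simp
qed

text \<open>Multilinearity alone gives polynomiality: expanding block \<open>s\<close> in unit
  vectors yields the coordinates \<open>\<xi> (s, j)\<close> times values with one block fewer taken
  from \<open>\<xi>\<close>. The induction runs downwards from \<open>s = n\<close>, where nothing
  depends on \<open>\<xi>\<close>.\<close>

lemma poly_fun_mix:
  assumes "s \<le> n"
  shows "(\<lambda>\<xi>. T (mix s n x \<xi>)) \<in> poly_fun (blockvars {..<n} d)"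
  using assms
proof (induction arbitrary: x rule: inc_induct)
  case base
  show ?case by (simp add: pf_const)
next
  case (step s)
  have "T (mix s n x \<xi>) = (\<Sum>j<d s. \<xi> (s, j) * T (mix (Suc s) n (setblk d x s (\<lambda>b. if b = j then 1 else 0)) \<xi>))"
    for \<xi>
  proof -
    have "T (mix s n x \<xi>) = T (setblk d (mix (Suc s) n x \<xi>) s (\<lambda>b. \<xi> (s, b)))"
    proof (rule mform_cong[OF T])
      show "mix s n x \<xi> (a, b) = setblk d (mix (Suc s) n x \<xi>) s (\<lambda>b. \<xi> (s, b)) (a, b)" if "b < d a" for a b
        using that step.hyps by (cases "a = s") (auto simp: mix_def setblk_def)
    qed
    also have "\<dots> = (\<Sum>j<d s. \<xi> (s, j) * T (setblk d (mix (Suc s) n x \<xi>) s (\<lambda>b. if b = j then 1 else 0)))"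
      by (rule mform_expand[OF T]) (use step in simp)
    also have "setblk d (mix (Suc s) n x \<xi>) s = (\<lambda>v. mix (Suc s) n (setblk d x s v) \<xi>)"
      by (auto simp: mix_def setblk_def fun_eq_iff)
    finally show ?thesis .
  qed
  moreover have "(\<lambda>\<xi>. \<Sum>j<d s. \<xi> (s, j) * T (mix (Suc s) n (setblk d x s (\<lambda>b. if b = j then 1 else 0)) \<xi>))
      \<in> poly_fun (blockvars {..<n} d)"
    by (intro poly_fun_sum pf_mult pf_var step.IH) (use step in \<open>auto simp: blockvars_def\<close>)
  ultimately show ?case
    by simp
qed

text \<open>Along this line only block \<open>s\<close> moves, so the form is affine in the
  parameter, and its slope is the value with \<open>x\<close> in block \<open>s\<close>.\<close>

lemma dirderiv_mix:
  assumes "s < n"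
  shows "dirderiv (\<lambda>\<xi>. T (mix s n x \<xi>)) \<xi> (\<lambda>v. if fst v = s then x v else 0) = T (mix (Suc s) n x \<xi>)"
proof -
  let ?w = "\<lambda>v. if fst v = s then x v else 0"
  have "T (mix s n x (\<lambda>v. \<xi> v + t * ?w v)) = T (mix s n x \<xi>) + t * T (mix (Suc s) n x \<xi>)" for t
  proof -
    have "T (mix s n x (\<lambda>v. \<xi> v + t * ?w v)) = T (setblk d (mix s n x \<xi>) s (\<lambda>b. t * x (s, b) + \<xi> (s, b)))"
      by (rule mform_cong[OF T]) (use assms in \<open>auto simp: mix_def setblk_def\<close>)
    also have "\<dots> = t * T (setblk d (mix s n x \<xi>) s (\<lambda>b. x (s, b))) + T (setblk d (mix s n x \<xi>) s (\<lambda>b. \<xi> (s, b)))"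
      by (rule mform_linear[OF T]) (use assms in simp)
    also have "T (setblk d (mix s n x \<xi>) s (\<lambda>b. x (s, b))) = T (mix (Suc s) n x \<xi>)"
    proof (rule mform_cong[OF T])
      show "setblk d (mix s n x \<xi>) s (\<lambda>b. x (s, b)) (a, b) = mix (Suc s) n x \<xi> (a, b)" if "b < d a" for a b
        using that by (cases "a = s") (auto simp: mix_def setblk_def)
    qed
    also have "T (setblk d (mix s n x \<xi>) s (\<lambda>b. \<xi> (s, b))) = T (mix s n x \<xi>)"
      by (rule mform_cong[OF T]) (use assms in \<open>auto simp: mix_def setblk_def\<close>)
    finally show ?thesis by simp
  qed
  then show ?thesis
    using dirderiv_eqI[of "[:T (mix s n x \<xi>), T (mix (Suc s) n x \<xi>):]" "\<lambda>\<xi>. T (mix s n x \<xi>)" \<xi> ?w] by simp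
qed

end

section \<open>Differentiating partition rank decompositions\<close>

text \<open>A summand \<open>p q\<close> splitting the blocks \<open>0, \<dots>, s - 1, n\<close>, with coefficients polynomial in the
  base point \<open>\<xi>\<close>; the last block always belongs to \<open>q\<close>.\<close>

type_synonym 'a summand =
  "nat set \<times> ((nat \<times> nat \<Rightarrow> 'a) \<Rightarrow> (nat \<times> nat \<Rightarrow> 'a) \<Rightarrow> 'a) \<times> ((nat \<times> nat \<Rightarrow> 'a) \<Rightarrow> (nat \<times> nat \<Rightarrow> 'a) \<Rightarrow> 'a)"

definition summand :: "nat \<Rightarrow> (nat \<Rightarrow> nat) \<Rightarrow> nat \<Rightarrow> 'a::field summand \<Rightarrow> bool" where
  "summand n d s = (\<lambda>(S, p, q). S \<noteq> {} \<and> S \<subseteq> {..<s} \<and>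
     (\<forall>\<xi>. mform S d (p \<xi>)) \<and> (\<forall>\<xi>. mform (({..<s} - S) \<union> {n}) d (q \<xi>)) \<and>
     (\<forall>x. (\<lambda>\<xi>. p \<xi> x) \<in> poly_fun (blockvars {..<n} d)) \<and>
     (\<forall>x. (\<lambda>\<xi>. q \<xi> x) \<in> poly_fun (blockvars {..<n} d)))"

definition summand_val :: "(nat \<times> nat \<Rightarrow> 'a) \<Rightarrow> (nat \<times> nat \<Rightarrow> 'a) \<Rightarrow> 'a::field summand \<Rightarrow> 'a" where
  "summand_val \<xi> x = (\<lambda>(S, p, q). p \<xi> x * q \<xi> x)"

lemma sum_sum_list_swap:
  "(\<Sum>b\<in>B. \<Sum>i\<leftarrow>L. f b i) = (\<Sum>i\<leftarrow>L. \<Sum>b\<in>B. f b i :: 'a::comm_monoid_add)"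
  by (induction L) (simp_all add: sum.distrib)

lemma finite_blockvars: "finite I \<Longrightarrow> finite (blockvars I d)"
  by (rule finite_subset[of _ "I \<times> (\<Union>i\<in>I. {..<d i})"]) (auto simp: blockvars_def)

text \<open>Tangent fields act only on identities valid on all of \<open>X\<close>, so the
  denominator \<open>g\<close> is kept as a function throughout the induction. One step turns each
  product into two and adds one for each coordinate outside \<open>B\<close>, whence
  \<open>2 * (2 ^ s - 1) + 1 = 2 ^ Suc s - 1\<close>.\<close>

lemma differentiated_decomposition:
  fixes n :: nat and d :: "nat \<Rightarrow> nat" and T :: "(nat \<times> nat \<Rightarrow> 'a::alg_closed_field) \<Rightarrow> 'a"
  defines "V \<equiv> blockvars {..<n} d"
  assumes dom: "domain_pts (V) X"
    and piv: "domain_pts.pivots (V) X (\<lambda>x. x) (V) B \<Delta> U"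
    and T: "mform {..<Suc n} d T"
    and ker: "\<And>\<xi> x. \<xi> \<in> X \<Longrightarrow> T (mix 0 n x \<xi>) = 0"
    and "s \<le> n"
  shows "\<exists>g L. g \<in> poly_fun (V) \<and> (\<exists>\<xi>\<in>X. g \<xi> \<noteq> 0) \<and>
    length L = (2 ^ s - 1) * card (V - B) \<and> (\<forall>t\<in>set L. summand n d s t) \<and>
    (\<forall>\<xi>\<in>X. \<forall>x. g \<xi> * T (mix s n x \<xi>) = (\<Sum>t\<leftarrow>L. summand_val \<xi> x t))"
  using \<open>s \<le> n\<close>
proof (induction s)
  case 0
  interpret domain_pts "V" X
    by (rule dom)
  show ?case
    using nonempty ker by (intro exI[of _ "\<lambda>_. 1"] exI[of _ "[]"]) (auto intro: pf_const)
next
  case (Suc s)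
  interpret domain_pts "V" X
    by (rule dom)
  have s: "s < n" "s \<le> n"
    using Suc.prems by auto
  have finV: "finite V"
    by (simp add: V_def finite_blockvars)
  have BV: "B \<subseteq> V" and \<Delta>: "\<Delta> \<in> poly_fun V" "\<exists>x\<in>X. \<Delta> x \<noteq> 0"
    and U: "\<And>b w. b \<in> B \<Longrightarrow> w \<in> V \<Longrightarrow> (\<lambda>x. U b x w) \<in> poly_fun V"
      "\<And>b. b \<in> B \<Longrightarrow> tangent (\<lambda>x. x) V (U b)"
      "\<And>b c x. b \<in> B \<Longrightarrow> c \<in> B \<Longrightarrow> x \<in> X \<Longrightarrow> U b x c = (if b = c then \<Delta> x else 0)"
    using piv unfolding pivots_def by blast+
  have finB: "finite B"
    using BV finV finite_subset by blast
  obtain g L where g: "g \<in> poly_fun V" "\<exists>\<xi>\<in>X. g \<xi> \<noteq> 0"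
    and len: "length L = (2 ^ s - 1) * card (V - B)" and L: "\<And>t. t \<in> set L \<Longrightarrow> summand n d s t"
    and dec: "\<And>\<xi> x. \<xi> \<in> X \<Longrightarrow> g \<xi> * T (mix s n x \<xi>) = (\<Sum>t\<leftarrow>L. summand_val \<xi> x t)"
    using Suc.IH[OF s(2)] by blast
  \<comment> \<open>The direction to be substituted is supported in block \<open>s\<close>, so only
    the pivots there receive a coefficient.\<close>
  define Bs where "Bs = {b \<in> B. fst b = s}"
  have Bs: "b \<in> B" "fst b = s" "snd b < d s" "b = (s, snd b)" if "b \<in> Bs" for b
    using that BV by (auto simp: Bs_def V_def blockvars_def)
  have finBs: "finite Bs"
    using finB by (simp add: Bs_def)
  define \<tau> where "\<tau> \<xi> x = T (mix s n x \<xi>)" for \<xi> x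
  have \<tau>p: "(\<lambda>\<xi>. \<tau> \<xi> x) \<in> poly_fun V" for x
    unfolding \<tau>_def V_def by (rule poly_fun_mix[OF T s(2)])
  have \<tau>m: "mform ({..<s} \<union> {n}) d (\<tau> \<xi>)" for \<xi>
    unfolding \<tau>_def by (rule mform_mix[OF T s(2)])
  define D where "D f b \<xi> = dirderiv f \<xi> (U b \<xi>)" for f b \<xi>
  have Dp: "D f b \<in> poly_fun V" if "f \<in> poly_fun V" "b \<in> B" for f b
    unfolding D_def by (rule poly_fun_dirderiv[OF that(1)]) (use U(1)[OF that(2)] in \<open>auto intro: pf_var\<close>)
  define unit :: "nat \<times> nat \<Rightarrow> nat \<times> nat \<Rightarrow> 'a" where "unit c v = (if v = c then 1 else 0)" for c v
  \<comment> \<open>The component at \<open>c\<close> of what remains of \<open>\<Delta>\<close>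
    times block \<open>s\<close> of \<open>x\<close> after removing the tangential part.\<close>
  define lf where "lf c \<xi> x = (if fst c = s then \<Delta> \<xi> * x c else 0) - (\<Sum>b\<in>Bs. U b \<xi> c * x b)" for c \<xi> x
  \<comment> \<open>Differentiating \<open>g * \<tau>\<close> also produces a term with
    \<open>D g\<close>. After multiplication by \<open>g\<close> it is a combination of the old
    products \<open>p q\<close>, so it is absorbed into their factors \<open>p\<close> and costs no
    further product.\<close>
  define P1 where "P1 p \<xi> x = (\<Sum>b\<in>Bs. x b * (g \<xi> * D (\<lambda>\<xi>. p \<xi> x) b \<xi> - D g b \<xi> * p \<xi> x))"
    for p :: "(nat \<times> nat \<Rightarrow> 'a) \<Rightarrow> (nat \<times> nat \<Rightarrow> 'a) \<Rightarrow> 'a" and \<xi> x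
  define Q2 where "Q2 q \<xi> x = (\<Sum>b\<in>Bs. x b * (g \<xi> * D (\<lambda>\<xi>. q \<xi> x) b \<xi>))"
    for q :: "(nat \<times> nat \<Rightarrow> 'a) \<Rightarrow> (nat \<times> nat \<Rightarrow> 'a) \<Rightarrow> 'a" and \<xi> x
  define Q3 where "Q3 c \<xi> x = (g \<xi>)\<^sup>2 * dirderiv (\<lambda>\<xi>. \<tau> \<xi> x) \<xi> (unit c)" for c \<xi> x
  obtain cs where cs: "set cs = V - B" "distinct cs"
    using finite_distinct_list[of "V - B"] finV by auto
  define L' where "L' = map (\<lambda>(S, p, q). (insert s S, P1 p, q)) L @ map (\<lambda>(S, p, q). (S, p, Q2 q)) L
    @ map (\<lambda>c. ({s}, lf c, Q3 c)) cs"
  have mult_block: "mform (insert s I) d (\<lambda>x. x b * p x)" if "mform I d p" "b \<in> Bs" "s \<notin> I" for I p b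
    using mform_mult_var[OF that(1,3), of "snd b"] Bs[OF that(2)] by simp
  have len': "length L' = (2 ^ Suc s - 1) * card (V - B)"
  proof -
    have "length cs = card (V - B)"
      using distinct_card[OF cs(2)] cs(1) by simp
    \<comment> \<open>Writing \<open>2 ^ s\<close> as a successor removes the truncated
      subtraction.\<close>
    moreover obtain a :: nat where "2 ^ s = Suc a"
      by (metis not0_implies_Suc power_not_zero zero_neq_numeral)
    ultimately show ?thesis
      by (simp add: L'_def len)
  qed
  have summand1: "summand n d (Suc s) (insert s S, P1 p, q)" "summand n d (Suc s) (S, p, Q2 q)"
    if "(S, p, q) \<in> set L" for S p q
  proof -
    have S: "S \<noteq> {}" "S \<subseteq> {..<s}" and pm: "\<And>\<xi>. mform S d (p \<xi>)"
      and qm: "\<And>\<xi>. mform (({..<s} - S) \<union> {n}) d (q \<xi>)"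
      and pp: "\<And>x. (\<lambda>\<xi>. p \<xi> x) \<in> poly_fun V" and qp: "\<And>x. (\<lambda>\<xi>. q \<xi> x) \<in> poly_fun V"
      using L[OF that] by (auto simp: summand_def V_def)
    have sets: "{..<Suc s} - insert s S = {..<s} - S" "{..<Suc s} - S \<union> {n} = insert s ({..<s} - S \<union> {n})"
      using S by auto
    have "mform (insert s S) d (P1 p \<xi>)" for \<xi>
      unfolding P1_def D_def
      by (intro mform_sum mult_block mform_diff mform_cmult mform_dirderiv[OF pm pp] pm) (use S in auto)
    moreover have "mform (insert s ({..<s} - S \<union> {n})) d (Q2 q \<xi>)" for \<xi>
      unfolding Q2_def D_def
      by (intro mform_sum mult_block mform_cmult mform_dirderiv[OF qm qp]) (use s in auto)
    moreover have "(\<lambda>\<xi>. P1 p \<xi> x) \<in> poly_fun V" for x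
      unfolding P1_def
      by (intro poly_fun_sum poly_fun_cmult poly_fun_diff pf_mult g(1) Dp pp Bs(1))
    moreover have "(\<lambda>\<xi>. Q2 q \<xi> x) \<in> poly_fun V" for x
      unfolding Q2_def by (intro poly_fun_sum poly_fun_cmult pf_mult g(1) Dp qp Bs(1))
    ultimately show "summand n d (Suc s) (insert s S, P1 p, q)" "summand n d (Suc s) (S, p, Q2 q)"
      unfolding summand_def prod.case sets using S pm qm pp qp by (auto simp: V_def)
  qed
  have summand3: "summand n d (Suc s) ({s}, lf c, Q3 c)" if c: "c \<in> V - B" for c
  proof -
    have "mform {s} d (\<lambda>x. x b * e)" if "fst b = s" "snd b < d s" for b and e :: 'a
      using mform_mult_var[OF mform_const[of d e], of s "snd b"] that by (cases b) auto
    then have blk: "mform {s} d (\<lambda>x. e * x b)" if "fst b = s" "snd b < d s" for b and e :: 'a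
      using that by (simp add: mult.commute)
    have "mform {s} d (\<lambda>x. if fst c = s then e * x c else 0)" for e :: 'a
      using blk[of c e] c by (cases "fst c = s") (auto simp: V_def blockvars_def mform_zero)
    then have "mform {s} d (lf c \<xi>)" for \<xi>
      unfolding lf_def by (intro mform_diff mform_sum blk Bs)
    moreover have "mform ({..<s} \<union> {n}) d (Q3 c \<xi>)" for \<xi>
      unfolding Q3_def by (intro mform_cmult mform_dirderiv[OF \<tau>m \<tau>p])
    moreover have "(\<lambda>\<xi>. lf c \<xi> x) \<in> poly_fun V" for x
      unfolding lf_def
    proof (rule poly_fun_diff)
      show "(\<lambda>\<xi>. if fst c = s then \<Delta> \<xi> * x c else 0) \<in> poly_fun V"
        using \<Delta>(1) by (cases "fst c = s") (auto intro: pf_mult pf_const)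
      show "(\<lambda>\<xi>. \<Sum>b\<in>Bs. U b \<xi> c * x b) \<in> poly_fun V"
        using c by (intro poly_fun_sum pf_mult pf_const U(1) Bs(1)) auto
    qed
    moreover have "(\<lambda>\<xi>. Q3 c \<xi> x) \<in> poly_fun V" for x
      unfolding Q3_def
      by (intro pf_mult poly_fun_power g(1) poly_fun_dirderiv[OF \<tau>p]) (auto intro: pf_var pf_const)
    moreover have "{..<Suc s} - {s} = {..<s}"
      by auto
    ultimately show ?thesis
      by (auto simp: summand_def V_def)
  qed
  have L': "\<forall>t\<in>set L'. summand n d (Suc s) t"
    using summand1 summand3 cs(1) unfolding L'_def by auto
  have main: "((g \<xi>)\<^sup>2 * \<Delta> \<xi>) * T (mix (Suc s) n x \<xi>) = (\<Sum>t\<leftarrow>L'. summand_val \<xi> x t)" if \<xi>: "\<xi> \<in> X" for \<xi> x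
  proof -
    let ?\<tau> = "\<lambda>\<xi>. \<tau> \<xi> x"
    let ?w = "\<lambda>v. if fst v = s then x v else 0"
    define p1 where "p1 b t = (case t of (S, p, q) \<Rightarrow> (g \<xi> * D (\<lambda>\<xi>. p \<xi> x) b \<xi> - D g b \<xi> * p \<xi> x) * q \<xi> x)"
      for b and t :: "'a summand"
    define q2 where "q2 b t = (case t of (S, p, q) \<Rightarrow> p \<xi> x * (g \<xi> * D (\<lambda>\<xi>. q \<xi> x) b \<xi>))"
      for b and t :: "'a summand"
    have deriv: "(g \<xi>)\<^sup>2 * D ?\<tau> b \<xi> = (\<Sum>t\<leftarrow>L. p1 b t + q2 b t)" if b: "b \<in> B" for b
    proof -
      have valp: "(\<lambda>\<xi>. summand_val \<xi> x t) \<in> poly_fun V"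
        and vald: "g \<xi> * dirderiv (\<lambda>\<xi>. summand_val \<xi> x t) \<xi> (U b \<xi>) - D g b \<xi> * summand_val \<xi> x t
          = p1 b t + q2 b t" if "t \<in> set L" for t
      proof -
        obtain S p q where t: "t = (S, p, q)"
          by (cases t)
        have pp: "(\<lambda>\<xi>. p \<xi> x) \<in> poly_fun V" and qp: "(\<lambda>\<xi>. q \<xi> x) \<in> poly_fun V"
          using L[OF that] by (auto simp: summand_def V_def t)
        show "(\<lambda>\<xi>. summand_val \<xi> x t) \<in> poly_fun V"
          by (simp add: summand_val_def t pf_mult pp qp)
        show "g \<xi> * dirderiv (\<lambda>\<xi>. summand_val \<xi> x t) \<xi> (U b \<xi>) - D g b \<xi> * summand_val \<xi> x t = p1 b t + q2 b t"
          by (simp add: summand_val_def t p1_def q2_def D_def dirderiv_mult[OF pp qp] algebra_simps)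
      qed
      have sump: "(\<lambda>\<xi>. \<Sum>t\<leftarrow>L. summand_val \<xi> x t) \<in> poly_fun V"
        by (intro poly_fun_sum_list valp)
      have gt: "(\<lambda>\<xi>. g \<xi> * \<tau> \<xi> x) \<in> poly_fun V"
        by (intro pf_mult g(1) \<tau>p)
      \<comment> \<open>The induction hypothesis holds on all of \<open>X\<close>, so the difference
        of its two sides is a relation there and the tangent field kills it.\<close>
      have "dirderiv (\<lambda>\<xi>. g \<xi> * \<tau> \<xi> x - (\<Sum>t\<leftarrow>L. summand_val \<xi> x t)) \<xi> (U b \<xi>) = 0"
        by (rule tangentD[OF U(2)[OF b] poly_fun_diff[OF gt sump] _ \<xi>]) (simp add: dec \<tau>_def)
      then have eq: "D g b \<xi> * \<tau> \<xi> x + g \<xi> * D ?\<tau> b \<xi> = (\<Sum>t\<leftarrow>L. dirderiv (\<lambda>\<xi>. summand_val \<xi> x t) \<xi> (U b \<xi>))"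
        by (simp add: dirderiv_diff[OF gt sump] dirderiv_mult[OF g(1) \<tau>p] dirderiv_sum_list[OF valp] D_def)
      have "(g \<xi>)\<^sup>2 * D ?\<tau> b \<xi> = g \<xi> * (D g b \<xi> * \<tau> \<xi> x + g \<xi> * D ?\<tau> b \<xi>) - D g b \<xi> * (g \<xi> * \<tau> \<xi> x)"
        by (simp add: power2_eq_square algebra_simps)
      also have "\<dots> = g \<xi> * (\<Sum>t\<leftarrow>L. dirderiv (\<lambda>\<xi>. summand_val \<xi> x t) \<xi> (U b \<xi>))
          - D g b \<xi> * (\<Sum>t\<leftarrow>L. summand_val \<xi> x t)"
        by (simp only: eq dec[OF \<xi>, of x, folded \<tau>_def])
      also have "\<dots> = (\<Sum>t\<leftarrow>L. g \<xi> * dirderiv (\<lambda>\<xi>. summand_val \<xi> x t) \<xi> (U b \<xi>) - D g b \<xi> * summand_val \<xi> x t)"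
        by (simp add: sum_list_const_mult sum_list_subtractf)
      also have "\<dots> = (\<Sum>t\<leftarrow>L. p1 b t + q2 b t)"
        using vald by (intro arg_cong[where f = sum_list] map_cong) auto
      finally show ?thesis .
    qed
    \<comment> \<open>Splits the direction into tangent fields and unit vectors outside
      \<open>B\<close>. At a pivot the echelon form leaves at most one term; elsewhere
      \<open>lf\<close> is exactly the remainder.\<close>
    have vec: "\<Delta> \<xi> * ?w v = (\<Sum>b\<in>Bs. x b * U b \<xi> v) + (\<Sum>c\<in>V - B. lf c \<xi> x * unit c v)" if v: "v \<in> V" for v
    proof (cases "v \<in> B")
      case True
      have "(\<Sum>b\<in>Bs. x b * U b \<xi> v) = (\<Sum>b\<in>Bs. if b = v then x v * \<Delta> \<xi> else 0)"
        using U(3)[OF Bs(1) True \<xi>] by (intro sum.cong) auto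
      also have "\<dots> = \<Delta> \<xi> * ?w v"
        using True finBs by (simp add: Bs_def)
      moreover have "(\<Sum>c\<in>V - B. lf c \<xi> x * unit c v) = 0"
        using True by (intro sum.neutral) (auto simp: unit_def)
      ultimately show ?thesis by simp
    next
      case False
      have "(\<Sum>c\<in>V - B. lf c \<xi> x * unit c v) = (\<Sum>c\<in>V - B. if c = v then lf v \<xi> x else 0)"
        by (intro sum.cong) (auto simp: unit_def)
      also have "\<dots> = lf v \<xi> x"
        using False v finV by simp
      finally show ?thesis
        by (simp add: lf_def mult.commute)
    qed
    have "\<Delta> \<xi> * T (mix (Suc s) n x \<xi>) = \<Delta> \<xi> * dirderiv ?\<tau> \<xi> ?w"
      unfolding \<tau>_def dirderiv_mix[OF T s(1)] ..
    also have "\<dots> = dirderiv ?\<tau> \<xi> (\<lambda>v. \<Delta> \<xi> * ?w v)"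
      using dirderiv_linear_dir[OF \<tau>p, of x \<xi> "\<Delta> \<xi>" ?w 0 ?w] by simp
    also have "\<dots> = dirderiv ?\<tau> \<xi> (\<lambda>v. 1 * (\<Sum>b\<in>Bs. x b * U b \<xi> v) + 1 * (\<Sum>c\<in>V - B. lf c \<xi> x * unit c v))"
      by (rule dirderiv_cong_dir[OF \<tau>p]) (simp only: vec mult_1)
    also have "\<dots> = (\<Sum>b\<in>Bs. x b * D ?\<tau> b \<xi>) + (\<Sum>c\<in>V - B. lf c \<xi> x * dirderiv ?\<tau> \<xi> (unit c))"
      by (subst dirderiv_linear_dir[OF \<tau>p]) (simp only: dirderiv_sum_dir[OF \<tau>p] D_def mult_1)
    finally have "(g \<xi>)\<^sup>2 * (\<Delta> \<xi> * T (mix (Suc s) n x \<xi>))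
        = (\<Sum>b\<in>Bs. x b * ((g \<xi>)\<^sup>2 * D ?\<tau> b \<xi>)) + (\<Sum>c\<in>V - B. lf c \<xi> x * Q3 c \<xi> x)"
      by (simp add: distrib_left sum_distrib_left Q3_def mult_ac)
    also have "(\<Sum>b\<in>Bs. x b * ((g \<xi>)\<^sup>2 * D ?\<tau> b \<xi>)) = (\<Sum>b\<in>Bs. \<Sum>t\<leftarrow>L. x b * p1 b t + x b * q2 b t)"
      using deriv[OF Bs(1)] by (intro sum.cong) (simp_all add: sum_list_const_mult[symmetric] distrib_left)
    also have "\<dots> = (\<Sum>t\<leftarrow>L. \<Sum>b\<in>Bs. x b * p1 b t) + (\<Sum>t\<leftarrow>L. \<Sum>b\<in>Bs. x b * q2 b t)"
      by (simp add: sum_sum_list_swap sum_list_addf sum.distrib)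
    also have "(\<Sum>t\<leftarrow>L. \<Sum>b\<in>Bs. x b * p1 b t) = (\<Sum>t\<leftarrow>map (\<lambda>(S, p, q). (insert s S, P1 p, q)) L. summand_val \<xi> x t)"
      unfolding map_map
      by (intro arg_cong[where f = sum_list] map_cong)
        (auto simp: p1_def summand_val_def P1_def sum_distrib_right mult.assoc)
    also have "(\<Sum>t\<leftarrow>L. \<Sum>b\<in>Bs. x b * q2 b t) = (\<Sum>t\<leftarrow>map (\<lambda>(S, p, q). (S, p, Q2 q)) L. summand_val \<xi> x t)"
      unfolding map_map
      by (intro arg_cong[where f = sum_list] map_cong)
        (auto simp: q2_def summand_val_def Q2_def sum_distrib_left mult_ac)
    also have "(\<Sum>c\<in>V - B. lf c \<xi> x * Q3 c \<xi> x) = (\<Sum>t\<leftarrow>map (\<lambda>c. ({s}, lf c, Q3 c)) cs. summand_val \<xi> x t)"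
      unfolding cs(1)[symmetric] using cs(2)
      by (simp add: sum_list_distinct_conv_sum_set summand_val_def o_def)
    finally show ?thesis
      by (simp add: L'_def mult.assoc)
  qed
  have "(\<lambda>\<xi>. (g \<xi>)\<^sup>2 * \<Delta> \<xi>) \<in> poly_fun V"
    by (intro pf_mult poly_fun_power g(1) \<Delta>(1))
  moreover have "\<exists>\<xi>\<in>X. (g \<xi>)\<^sup>2 * \<Delta> \<xi> \<noteq> 0"
    using mult_nonzero[OF g(1) \<Delta>(1) g(2) \<Delta>(2)] by auto
  ultimately show ?case
    using len' L' main by blast
qed

section \<open>Specialisation and the role of the dimension\<close>

text \<open>The identity is evaluated at one point with \<open>g \<xi> \<noteq> 0\<close>, and the
  scalar \<open>inverse (g \<xi>)\<close> goes into \<open>p\<close>. Every \<open>S j\<close>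
  avoids the last block \<open>n\<close>, which makes it a proper subset.\<close>

lemma partition_rank_le_card_complement_pivots:
  fixes T :: "(nat \<times> nat \<Rightarrow> 'a::alg_closed_field) \<Rightarrow> 'a"
  assumes T: "multilinear {..<Suc n} d T"
    and dom: "domain_pts (blockvars {..<n} d) X"
    and X: "X \<subseteq> tensor_kernel (Suc n) d T"
    and piv: "domain_pts.pivots (blockvars {..<n} d) X (\<lambda>x. x) (blockvars {..<n} d) B \<Delta> U"
  shows "partition_rank (Suc n) d T \<le> (2 ^ n - 1) * card (blockvars {..<n} d - B)"
proof -
  define T' where "T' x = T (trunc_pt (Suc n) d x)" for x
  have T': "mform {..<Suc n} d T'"
    unfolding T'_def by (rule multilinear_trunc_mform[OF T])
  have T'_eq: "T' x = T x" if "x \<in> pt_space (blockvars {..<Suc n} d)" for x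
    by (simp add: T'_def trunc_pt_eq[OF that])
  have ker: "T' (mix 0 n x \<xi>) = 0" if "\<xi> \<in> X" for \<xi> x
  proof -
    have \<xi>: "\<xi> \<in> pt_space (blockvars {..<n} d)"
      and zero: "T (setblk d \<xi> n (\<lambda>b. if b = j then 1 else 0)) = 0" if "j < d n" for j
      using X \<open>\<xi> \<in> X\<close> that by (auto simp: tensor_kernel_def)
    have "setblk d \<xi> n v \<in> pt_space (blockvars {..<Suc n} d)" for v
      using X \<open>\<xi> \<in> X\<close> by (auto simp: tensor_kernel_def pt_space_def setblk_def blockvars_def)
    then have zero': "T' (setblk d \<xi> n (\<lambda>b. if b = j then 1 else 0)) = 0" if "j < d n" for j
      using zero[OF that] T'_eq by simp
    \<comment> \<open>Only the last block is still free, and the kernel equations are the values on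
      its unit vectors.\<close>
    have "T' (mix 0 n x \<xi>) = T' (setblk d \<xi> n (\<lambda>b. x (n, b)))"
      by (rule mform_cong[OF T']) (auto simp: mix_def setblk_def)
    also have "\<dots> = 0"
      using mform_expand[OF T', of n \<xi>] zero' by simp
    finally show ?thesis .
  qed
  obtain g L where g: "\<exists>\<xi>\<in>X. g \<xi> \<noteq> 0"
    and len: "length L = (2 ^ n - 1) * card (blockvars {..<n} d - B)"
    and L: "\<And>t. t \<in> set L \<Longrightarrow> summand n d n t"
    and dec: "\<And>\<xi> x. \<xi> \<in> X \<Longrightarrow> g \<xi> * T' (mix n n x \<xi>) = (\<Sum>t\<leftarrow>L. summand_val \<xi> x t)"
    using differentiated_decomposition[OF dom piv T' ker order_refl] by blast
  obtain \<xi> where \<xi>: "\<xi> \<in> X" "g \<xi> \<noteq> 0"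
    using g by blast
  define S where "S j = fst (L ! j)" for j
  define p where "p j x = inverse (g \<xi>) * fst (snd (L ! j)) \<xi> x" for j x
  define q where "q j x = snd (snd (L ! j)) \<xi> x" for j x
  have sets: "{..<Suc n} - S' = ({..<n} - S') \<union> {n}" if "S' \<subseteq> {..<n}" for S'
    using that by auto
  have Lj: "S j \<noteq> {}" "S j \<subseteq> {..<n}" "mform (S j) d (p j)" "mform ({..<Suc n} - S j) d (q j)"
    if "j < length L" for j
    using L[OF nth_mem[OF that]] unfolding S_def p_def q_def
    by (cases "L ! j"; auto simp: summand_def sets intro!: mform_cmult)+
  have decT: "T x = (\<Sum>j<length L. p j (restr x (S j)) * q j (restr x ({..<Suc n} - S j)))"
    if "x \<in> pt_space (blockvars {..<Suc n} d)" for x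
  proof -
    have "T x = inverse (g \<xi>) * (\<Sum>t\<leftarrow>L. summand_val \<xi> x t)"
      using dec[OF \<xi>(1), of x] \<xi>(2) T'_eq[OF that] by (simp add: field_simps)
    also have "\<dots> = (\<Sum>j<length L. p j x * q j x)"
      by (simp add: sum_list_sum_nth atLeast0LessThan sum_distrib_left summand_val_def p_def q_def
          case_prod_beta mult.assoc)
    also have "\<dots> = (\<Sum>j<length L. p j (restr x (S j)) * q j (restr x ({..<Suc n} - S j)))"
      by (intro sum.cong refl) (simp add: mform_restr[OF Lj(3)] mform_restr[OF Lj(4)])
    finally show ?thesis .
  qed
  have "partition_rank (Suc n) d T \<le> length L"
    unfolding partition_rank_def
  proof (rule Least_le, rule exI[of _ S], rule exI[of _ p], rule exI[of _ q], intro conjI allI impI ballI)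
    fix j assume j: "j < length L"
    show "S j \<noteq> {}" "S j \<subset> {..<Suc n}"
      using Lj(1,2)[OF j] by auto
    show "multilinear (S j) d (p j)" "multilinear ({..<Suc n} - S j) d (q j)"
      using Lj(3,4)[OF j] by (auto intro: mform_multilinear)
  qed (rule decT)
  then show ?thesis
    by (simp add: len)
qed

text \<open>For \<open>n > 0\<close> block 0 is a zero block different from block \<open>n\<close>,
  so multilinearity gives the value 0. The kernel is thus nonempty and has a well-behaved
  dimension.\<close>

lemma zero_in_tensor_kernel:
  assumes "multilinear {..<Suc n} d T" "n > 0"
  shows "(\<lambda>v. 0) \<in> tensor_kernel (Suc n) d T"
proof -
  have "T (setblk d (\<lambda>v. 0) n u) = 0" for u
  proof -
    let ?x = "setblk d (\<lambda>v. 0) n u"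
    have x: "?x \<in> pt_space (blockvars {..<Suc n} d)"
      by (auto simp: pt_space_def setblk_def blockvars_def)
    have "T (trunc_pt (Suc n) d (setblk d ?x 0 (\<lambda>b. 0))) = 0"
      by (rule mform_setblk_zero[OF multilinear_trunc_mform[OF assms(1)]]) simp
    moreover have "setblk d ?x 0 (\<lambda>b. 0) = ?x"
      using assms(2) by (auto simp: setblk_def fun_eq_iff)
    ultimately show ?thesis
      by (simp add: trunc_pt_eq[OF x])
  qed
  then show ?thesis
    by (simp add: tensor_kernel_def pt_space_def)
qed

text \<open>\<open>Sup\<close> of a finite nonempty set of naturals is its maximum. A one-point
  chain gives nonemptiness; finiteness comes from \<open>pivots_of_chain\<close>, since the pivots
  form a subset of \<open>V\<close> and no chain is longer than \<open>card V\<close>.\<close>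

lemma zariski_dim_attained:
  fixes Z :: "('v \<Rightarrow> 'a::alg_closed_field) set"
  assumes fin: "finite V" and x: "x \<in> Z" "x \<in> pt_space V"
  obtains C where "\<And>i. i \<le> zariski_dim V Z \<Longrightarrow> zariski_irreducible V (C i) \<and> C i \<subseteq> Z"
    "\<And>i. i < zariski_dim V Z \<Longrightarrow> C i \<subset> C (Suc i)"
proof -
  define M where "M = {m. \<exists>C :: nat \<Rightarrow> ('v \<Rightarrow> 'a) set.
       (\<forall>i \<le> m. zariski_irreducible V (C i) \<and> C i \<subseteq> Z) \<and> (\<forall>i < m. C i \<subset> C (Suc i))}"
  have "m \<le> card V" if "m \<in> M" for m
  proof -
    from that[unfolded M_def] obtain C :: "nat \<Rightarrow> ('v \<Rightarrow> 'a) set" where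
      C: "\<And>i. i \<le> m \<Longrightarrow> zariski_irreducible V (C i)" "\<And>i. i < m \<Longrightarrow> C i \<subset> C (Suc i)"
      by blast
    interpret domain_pts V "C m"
      by (rule zariski_irreducible_domain_pts[OF C(1)]) simp
    obtain B \<Delta> U where "pivots (\<lambda>x. x) V B \<Delta> U" "m \<le> card B"
      using pivots_of_chain[of V m C] fin C by blast
    moreover from this have "card B \<le> card V"
      by (intro card_mono fin) (simp add: pivots_def)
    ultimately show ?thesis
      by simp
  qed
  then have "finite M"
    by (meson finite_nat_set_iff_bounded_le)
  moreover have "0 \<in> M"
    unfolding M_def using zariski_irreducible_singleton[OF x(2)] x(1) by (auto intro!: exI[of _ "\<lambda>_. {x}"])
  ultimately have "Sup M \<in> M"
    using Max_in[of M] by (auto simp: Sup_nat_def)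
  then have "zariski_dim V Z \<in> M"
    by (simp add: zariski_dim_def M_def)
  then show thesis
    using that unfolding M_def by blast
qed

theorem theorem1p3:
  fixes k :: nat and d :: "nat \<Rightarrow> nat" and T :: "(nat \<times> nat \<Rightarrow> 'a::alg_closed_field) \<Rightarrow> 'a"
  assumes "k \<ge> 2"
    and "multilinear {..<k} d T"
  shows "partition_rank k d T \<le> (2 ^ (k - 1) - 1) * geometric_rank k d T"
proof -
  define n where "n = k - 1"
  have k: "k = Suc n" "n > 0"
    using assms(1) by (auto simp: n_def)
  have T: "multilinear {..<Suc n} d T"
    using assms(2) k by simp
  define V where "V = blockvars {..<n} d"
  have fin: "finite V"
    by (simp add: V_def finite_blockvars)
  define m where "m = zariski_dim V (tensor_kernel k d T)"
  obtain C where C: "\<And>i. i \<le> m \<Longrightarrow> zariski_irreducible V (C i) \<and> C i \<subseteq> tensor_kernel k d T"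
      "\<And>i. i < m \<Longrightarrow> C i \<subset> C (Suc i)"
    using zariski_dim_attained[OF fin zero_in_tensor_kernel[OF T k(2)]] unfolding m_def k(1)
    by (auto simp: pt_space_def)
  interpret domain_pts V "C m"
    by (rule zariski_irreducible_domain_pts) (use C(1) in simp)
  obtain B \<Delta> U where piv: "pivots (\<lambda>x. x) V B \<Delta> U" and card: "m \<le> card B"
    using pivots_of_chain[of V m C] fin C by blast
  have BV: "B \<subseteq> V"
    using piv by (simp add: pivots_def)
  have "partition_rank k d T \<le> (2 ^ n - 1) * card (V - B)"
    unfolding k V_def
    by (rule partition_rank_le_card_complement_pivots[OF T])
      (use C(1)[of m] domain_pts_axioms piv in \<open>auto simp: V_def k\<close>)
  \<comment> \<open>The natural subtraction does not truncate: \<open>B\<close> lies in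
    \<open>V\<close> and has at least \<open>m\<close> elements.\<close>
  also have "card (V - B) \<le> card V - m"
    using card BV fin by (simp add: card_Diff_subset finite_subset)
  also have "card V - m = geometric_rank k d T"
    by (simp add: geometric_rank_def V_def m_def n_def)
  finally show ?thesis
    by (simp add: n_def)
qed

end
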